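(* Let $\mathbb{K}$ be a field. For all sufficiently large $n$: $$\mathrm{Gap}_{\mathbb K}\,rpRo_n^T\le \sqrt2\,e^{2+\frac{1}{3n}}\cdot 2^{-n}\cdot \mathrm{Gap}_{\mathbb K}\,pRo_n^T,$$ $$\mathrm{Ratio}_{\mathbb K}\,rpRo_n^T\le \pi^{1/4}e^{2+\frac1{3n}}\cdot n^{1/4}\cdot 0.87^n\cdot \mathrm{Ratio}_{\mathbb K}\,pRo_n^T.$$
   Context: Diagrams. The planar rook monoid $pRo_n$ (here on $2n$ strands) consists of all planar partitions of $2n$ top points and $2n$ bottom points into blocks of size $1$ (dots) and blocks of size $2$ each joining a top point to a bottom point (through strands). The rigid planar rook monoid $rpRo_n$ is the submonoid of those diagrams where, after labelling both the top and the bottom points from left to right by $1\,2\,1\,2\cdots1\,2$ (length $2n$), every through strand joins points with the same letter. The product $ab$ stacks $a$ on top of $b$, follows strings, and removes pieces not connected to outer points (an outer point whose string ends in a dot becomes a dot). Truncation. For $M$ one of these monoids, $M^{a\le k\le b}$ consists of the diagrams of $M$ with $k$ through strands, $a\le k\le b$, together with an adjoined zero (if diagrams with fewer than $a$ through strands exist) to which products with fewer than $a$ through strands are collapsed, and an adjoined unit if the identity is not already included. Set $pRo_n^T=pRo_n^{\,n-\sqrt{2n}\le k\le n+\sqrt{2n}}$ and $rpRo_n^T=rpRo_n^{\,\frac n2-\sqrt{2n}\le k\le\frac n2+\sqrt{2n}}$. Gaps. A representation is trivial if it is isomorphic to the one-dimensional representation where units act by $1$ and all other elements by $0$, or the one where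 all elements act by $1$. $\mathrm{Gap}_{\mathbb K}(M)$ is the smallest dimension of a nontrivial simple representation of $M$ over $\mathbb K$. $\mathrm{Ratio}_{\mathbb K}(rpRo_n^T)=\mathrm{Gap}_{\mathbb K}(rpRo_n^T)/\sqrt{|rpRo_n^T|}$, and $\mathrm{Ratio}_{\mathbb K}(pRo_n^T)=\mathrm{Gap}_{\mathbb K}(pRo_n^T)/\sqrt{|pRo_n|}$ (size of the full monoid, following the paper's convention). *)

theory Defs
  imports
    Complex_Main
    "HOL-Library.Disjoint_Sets"
    "Jordan_Normal_Form.VS_Connect"
begin

section \<open>The planar rook monoid and its rigid version\<close>

datatype point = Top nat | Bot nat

definition points :: "nat \<Rightarrow> point set" where
  "points N = Top ` {1..N} \<union> Bot ` {1..N}"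

text \<open>A diagram is a set partition of the points, given as its set of blocks.\<close>

definition strands :: "point set set \<Rightarrow> (nat \<times> nat) set" where
  "strands D = {(i, j). {Top i, Bot j} \<in> D}"

definition num_strands :: "point set set \<Rightarrow> nat" where
  "num_strands D = card (strands D)"

text \<open>Since dots never obstruct a planar drawing, planarity means that no two through
  strands cross.\<close>

definition planar :: "point set set \<Rightarrow> bool" where
  "planar D \<longleftrightarrow> (\<forall>(i, j) \<in> strands D. \<forall>(i', j') \<in> strands D. i < i' \<longrightarrow> j < j')"

definition planar_rook_diagrams :: "nat \<Rightarrow> point set set set" where
  "planar_rook_diagrams N = {D. partition_on (points N) D
     \<and> (\<forall>B \<in> D. (\<exists>p. B = {p}) \<or> (\<exists>i j. B = {Top i, Bot j}))
     \<and> planar D}"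

text \<open>The diagram with the given through strands and dots at all remaining points.\<close>

definition diagram_of :: "nat \<Rightarrow> (nat \<times> nat) set \<Rightarrow> point set set" where
  "diagram_of N R = (\<lambda>(i, j). {Top i, Bot j}) ` R
     \<union> (\<lambda>i. {Top i}) ` ({1..N} - Domain R)
     \<union> (\<lambda>j. {Bot j}) ` ({1..N} - Range R)"

text \<open>When \<open>a\<close> is stacked on top of \<open>b\<close>, the top point \<open>i\<close> is connected to the bottom point \<open>j\<close>
  iff some middle point is joined to \<open>i\<close> in \<open>a\<close> and to \<open>j\<close> in \<open>b\<close>. All other strings starting
  at outer points end in dots.\<close>

definition stack :: "nat \<Rightarrow> point set set \<Rightarrow> point set set \<Rightarrow> point set set" where
  "stack N a b = diagram_of N (strands a O strands b)"

definition pRo :: "nat \<Rightarrow> point set set monoid" where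
  "pRo n = \<lparr>carrier = planar_rook_diagrams (2 * n),
            mult = stack (2 * n),
            one = diagram_of (2 * n) (Id_on {1..2 * n})\<rparr>"

text \<open>The labelling \<open>1 2 1 2 \<dots> 1 2\<close> of the positions \<open>1, \<dots>, 2n\<close>.\<close>

definition letter :: "nat \<Rightarrow> nat" where
  "letter i = (if odd i then 1 else 2)"

definition rpRo :: "nat \<Rightarrow> point set set monoid" where
  "rpRo n = (pRo n)\<lparr>carrier := {D \<in> carrier (pRo n). \<forall>(i, j) \<in> strands D. letter i = letter j}\<rparr>"


section \<open>Truncations\<close>

datatype 'd truncated = Diag 'd | Zero | Unit

text \<open>\<open>Zero\<close> and \<open>Unit\<close> are the adjoined zero and the adjoined unit. They belong to the carrier
  only under the respective condition; otherwise the unit is the identity diagram.\<close>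

fun trunc_mult :: "real \<Rightarrow> point set set monoid \<Rightarrow>
    point set set truncated \<Rightarrow> point set set truncated \<Rightarrow> point set set truncated" where
  "trunc_mult a M Unit y = y"
| "trunc_mult a M x Unit = x"
| "trunc_mult a M Zero y = Zero"
| "trunc_mult a M x Zero = Zero"
| "trunc_mult a M (Diag c) (Diag d) =
     (if real (num_strands (c \<otimes>\<^bsub>M\<^esub> d)) < a then Zero else Diag (c \<otimes>\<^bsub>M\<^esub> d))"

definition truncation :: "real \<Rightarrow> real \<Rightarrow> point set set monoid \<Rightarrow> point set set truncated monoid" where
  "truncation a b M =
     (let in_range = (\<lambda>d. a \<le> real (num_strands d) \<and> real (num_strands d) \<le> b) in
      \<lparr>carrier = Diag ` {d \<in> carrier M. in_range d}
          \<union> (if \<exists>d \<in> carrier M. real (num_strands d) < a then {Zero} else {})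
          \<union> (if in_range \<one>\<^bsub>M\<^esub> then {} else {Unit}),
       mult = trunc_mult a M,
       one = (if in_range \<one>\<^bsub>M\<^esub> then Diag \<one>\<^bsub>M\<^esub> else Unit)\<rparr>)"

definition pRoT :: "nat \<Rightarrow> point set set truncated monoid" where
  "pRoT n = truncation (real n - sqrt (2 * real n)) (real n + sqrt (2 * real n)) (pRo n)"

definition rpRoT :: "nat \<Rightarrow> point set set truncated monoid" where
  "rpRoT n = truncation (real n / 2 - sqrt (2 * real n)) (real n / 2 + sqrt (2 * real n)) (rpRo n)"


section \<open>Representations, gap and ratio\<close>

text \<open>Simple representations of a finite monoid are finite-dimensional, so only representations
  on coordinate spaces \<open>K\<^sup>d\<close>, given by \<open>d \<times> d\<close> matrices, are considered.\<close>

definition representation :: "('a, 'b) monoid_scheme \<Rightarrow> nat \<Rightarrow> ('a \<Rightarrow> 'k :: field mat) \<Rightarrow> bool" where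
  "representation M d \<rho> \<longleftrightarrow>
     (\<forall>x \<in> carrier M. \<rho> x \<in> carrier_mat d d)
     \<and> \<rho> \<one>\<^bsub>M\<^esub> = 1\<^sub>m d
     \<and> (\<forall>x \<in> carrier M. \<forall>y \<in> carrier M. \<rho> (x \<otimes>\<^bsub>M\<^esub> y) = \<rho> x * \<rho> y)"

definition simple_representation :: "('a, 'b) monoid_scheme \<Rightarrow> nat \<Rightarrow> ('a \<Rightarrow> 'k :: field mat) \<Rightarrow> bool" where
  "simple_representation M d \<rho> \<longleftrightarrow>
     representation M d \<rho> \<and> d \<noteq> 0
     \<and> (\<forall>W. subspace class_ring W (module_vec TYPE('k) d)
            \<and> (\<forall>x \<in> carrier M. \<forall>w \<in> W. \<rho> x *\<^sub>v w \<in> W)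
          \<longrightarrow> W = {0\<^sub>v d} \<or> W = carrier_vec d)"

definition isomorphic_representations ::
  "('a, 'b) monoid_scheme \<Rightarrow> nat \<Rightarrow> ('a \<Rightarrow> 'k :: field mat) \<Rightarrow> nat \<Rightarrow> ('a \<Rightarrow> 'k mat) \<Rightarrow> bool" where
  "isomorphic_representations M d \<rho> d' \<rho>' \<longleftrightarrow>
     d = d' \<and> (\<exists>P \<in> carrier_mat d d. invertible_mat P \<and> (\<forall>x \<in> carrier M. P * \<rho> x = \<rho>' x * P))"

definition trivial_representation :: "('a, 'b) monoid_scheme \<Rightarrow> nat \<Rightarrow> ('a \<Rightarrow> 'k :: field mat) \<Rightarrow> bool" where
  "trivial_representation M d \<rho> \<longleftrightarrow>
     isomorphic_representations M d \<rho> 1 (\<lambda>x. if x \<in> Units M then 1\<^sub>m 1 else 0\<^sub>m 1 1)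
     \<or> isomorphic_representations M d \<rho> 1 (\<lambda>x. 1\<^sub>m 1)"

text \<open>The type argument is the ground field.\<close>

definition gap :: "'k :: field itself \<Rightarrow> ('a, 'b) monoid_scheme \<Rightarrow> nat" where
  "gap K M = (LEAST d. \<exists>\<rho> :: 'a \<Rightarrow> 'k mat.
     simple_representation M d \<rho> \<and> \<not> trivial_representation M d \<rho>)"

definition ratio_rpRoT :: "'k :: field itself \<Rightarrow> nat \<Rightarrow> real" where
  "ratio_rpRoT K n = real (gap K (rpRoT n)) / sqrt (real (card (carrier (rpRoT n))))"

text \<open>By convention the planar rook ratio is normalised by the size of the full, untruncated
  monoid.\<close>

definition ratio_pRoT :: "'k :: field itself \<Rightarrow> nat \<Rightarrow> real" where
  "ratio_pRoT K n = real (gap K (pRoT n)) / sqrt (real (card (carrier (pRo n))))"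

end

theory Submission
  imports Defs "HOL-Analysis.Convex" "HOL-Real_Asymp.Real_Asymp"
begin

text \<open>
  A planar rook diagram is determined by the set \<open>S\<close> of top ends and the set \<open>T\<close> of bottom ends of its
  through strands, because planarity forces the strands to realise the unique increasing bijection
  \<open>S \<rightarrow> T\<close>. Stacking is composition of these partial bijections, so everything below is about
  order-preserving partial injections of \<open>{1..2n}\<close>.

  The planar gap is at least some \<open>2n choose k\<close> with \<open>k\<close> in the planar window. In a simple
  representation, the kernel of the adjoined zero is a subrepresentation. So the zero acts as the identity, and then everything does and
  the representation is trivial, or the zero acts as \<open>0\<close>. In the second case, if every diagram acted
  as \<open>0\<close>, the representation would be the other trivial one. Otherwise take a diagram of
  least rank \<open>k\<close> whose matrix is nonzero. The identity diagrams on the \<open>k\<close>-element subsets of \<open>{1..2n}\<close>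
  are all equivalent to it, hence act as nonzero idempotents; two different ones multiply to a diagram
  of smaller rank or to zero, so the idempotents are orthogonal. There are \<open>2n choose k\<close> of them,
  which bounds the dimension from below (\<open>nontrivial_simple_dim_ge\<close>).

  The rigid gap is much smaller, because rigid strands preserve the parity of
  positions, so \<open>rpRo\<close> acts on the \<open>l\<close>-element sets of odd positions, of which there are only
  \<open>n choose l\<close>. Diagrams of rank \<open>l\<close> act as matrix units, so this representation is simple
  (\<open>subset_rep_simple\<close>). One may choose \<open>l\<close> in the truncation window: about \<open>2 sqrt (2n)\<close> binomial
  coefficients \<open>n choose l\<close> lie there and they add up to at most \<open>2^n\<close>, so one of them is at most
  about \<open>2^n / (2 sqrt (2n))\<close>. In the planar window, on the other hand,
  \<open>2n choose k\<close> is at least about \<open>exp (-2) * 4^n / (2 sqrt n)\<close>. The quotient of these bounds is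
  \<open>2^(-n) * exp 2 / sqrt 2\<close>, half of what the theorem allows, and this factor of two
  absorbs the error terms.

  Given the estimate for the gaps, the ratios only require comparing the sizes of the monoids.
  The planar monoid has at most \<open>16^n\<close> elements. A pair of \<open>k\<close>-element subsets of \<open>{1..2n}\<close> with the same
  word of letters gives a rigid diagram; as there are at most \<open>2^k\<close> words, the Cauchy-Schwarz inequality
  yields at least \<open>(2n choose k)\<^sup>2 / 2^k\<close> rigid diagrams. For \<open>k = n div 2\<close> this is at least of order
  \<open>32^(n div 2)\<close>, which beats the required growth rate \<open>(2 / 0.87)^(2n)\<close>, because
  \<open>32 > (2 / 0.87)^4\<close>.
\<close>

section \<open>Diagrams as order-preserving partial injections\<close>

text \<open>The graphs of order-preserving partial injections. One equivalence encodes everything: equal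
  first components force equal second components and conversely.\<close>

definition order_rels :: "nat \<Rightarrow> (nat \<times> nat) set set" where
  "order_rels N = {R. R \<subseteq> {1..N} \<times> {1..N}
     \<and> (\<forall>(i, j) \<in> R. \<forall>(i', j') \<in> R. i < i' \<longleftrightarrow> j < j')}"

lemma order_relsD:
  assumes "R \<in> order_rels N" "(i, j) \<in> R" "(i', j') \<in> R"
  shows "i < i' \<longleftrightarrow> j < j'" "i = i' \<longleftrightarrow> j = j'"
proof -
  have *: "\<And>i j i' j'. (i, j) \<in> R \<Longrightarrow> (i', j') \<in> R \<Longrightarrow> i < i' \<longleftrightarrow> j < j'"
    using assms(1) by (auto simp: order_rels_def)
  show "i < i' \<longleftrightarrow> j < j'" using * assms by blast
  show "i = i' \<longleftrightarrow> j = j'" using *[OF assms(2,3)] *[OF assms(3,2)] by auto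
qed

lemma order_relsI:
  assumes "R \<subseteq> {1..N} \<times> {1..N}"
    and "\<And>i j i' j'. (i, j) \<in> R \<Longrightarrow> (i', j') \<in> R \<Longrightarrow> i < i' \<longleftrightarrow> j < j'"
  shows "R \<in> order_rels N"
  unfolding order_rels_def using assms by blast

lemma order_rels_bounded: "R \<in> order_rels N \<Longrightarrow> R \<subseteq> {1..N} \<times> {1..N}"
  by (simp add: order_rels_def)

lemma finite_order_rel: "R \<in> order_rels N \<Longrightarrow> finite R"
  by (rule finite_subset[OF order_rels_bounded]) auto

lemma finite_order_rels: "finite (order_rels N)"
  by (rule finite_subset[of _ "Pow ({1..N} \<times> {1..N})"]) (auto simp: order_rels_def)

lemma order_rels_single_valued: "R \<in> order_rels N \<Longrightarrow> single_valued R"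
  unfolding single_valued_def using order_relsD(2) by blast

lemma order_rels_comp:
  assumes R: "R \<in> order_rels N" and R': "R' \<in> order_rels N"
  shows "R O R' \<in> order_rels N"
proof -
  have "i < k \<longleftrightarrow> j < l" if ij: "(i, j) \<in> R O R'" and kl: "(k, l) \<in> R O R'" for i j k l
  proof -
    obtain x y where "(i, x) \<in> R" "(x, j) \<in> R'" "(k, y) \<in> R" "(y, l) \<in> R'"
      using ij kl by blast
    then show ?thesis using order_relsD(1)[OF R] order_relsD(1)[OF R'] by blast
  qed
  moreover have "R O R' \<subseteq> {1..N} \<times> {1..N}"
    using order_rels_bounded[OF R] order_rels_bounded[OF R'] by blast
  ultimately show ?thesis by (rule order_relsI[rotated])
qed

lemma card_Image_order_rel:
  assumes R: "R \<in> order_rels N" and S: "S \<subseteq> Domain R"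
  shows "card (R `` S) = card S"
proof -
  have "\<forall>i\<in>S. \<exists>j. (i, j) \<in> R" using S by blast
  then obtain f where f: "\<And>i. i \<in> S \<Longrightarrow> (i, f i) \<in> R" by metis
  have "R `` S = f ` S"
    using f order_relsD(2)[OF R] by blast
  moreover have "inj_on f S"
    using f order_relsD(2)[OF R] by (metis inj_onI)
  ultimately show ?thesis by (simp add: card_image)
qed

lemma card_Domain_order_rel:
  assumes R: "R \<in> order_rels N"
  shows "card (Domain R) = card R"
proof -
  have "inj_on fst R" using order_relsD(2)[OF R] by (auto simp: inj_on_def)
  then show ?thesis by (simp add: Domain_fst card_image)
qed

lemma card_Range_order_rel:
  assumes R: "R \<in> order_rels N"
  shows "card (Range R) = card R"
proof -
  have "R `` Domain R = Range R" by blast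
  then show ?thesis using card_Image_order_rel[OF R subset_refl] card_Domain_order_rel[OF R] by simp
qed

lemma Domain_order_rel: "R \<in> order_rels N \<Longrightarrow> Domain R \<subseteq> {1..N}"
  using order_rels_bounded by blast

lemma Range_order_rel: "R \<in> order_rels N \<Longrightarrow> Range R \<subseteq> {1..N}"
  using order_rels_bounded by blast

text \<open>The increasing bijection between two sets of the same size.\<close>

definition order_match :: "nat set \<Rightarrow> nat set \<Rightarrow> (nat \<times> nat) set" where
  "order_match S T = set (zip (sorted_list_of_set S) (sorted_list_of_set T))"

lemma order_match_props:
  assumes "S \<subseteq> {1..N}" "T \<subseteq> {1..N}" "card S = card T"
  shows order_match_order_rel: "order_match S T \<in> order_rels N"
    and Domain_order_match: "Domain (order_match S T) = S"
    and Range_order_match: "Range (order_match S T) = T"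
    and card_order_match: "card (order_match S T) = card S"
proof -
  have fin: "finite S" "finite T" using assms by (auto intro: finite_subset)
  let ?s = "sorted_list_of_set S" and ?t = "sorted_list_of_set T"
  have len: "length ?s = length ?t" using assms fin by simp
  have "map fst (zip ?s ?t) = ?s" "map snd (zip ?s ?t) = ?t" using len by simp_all
  then have "fst ` order_match S T = set ?s" "snd ` order_match S T = set ?t"
    unfolding order_match_def image_set by simp_all
  then show D: "Domain (order_match S T) = S" and R: "Range (order_match S T) = T"
    using fin by (simp_all add: Domain_fst Range_snd)
  have mono: "xs ! p < xs ! q \<longleftrightarrow> p < q"
    if "sorted_wrt (<) xs" "p < length xs" "q < length xs" for xs :: "nat list" and p q
    using sorted_wrt_nth_less[OF that(1), of p q] sorted_wrt_nth_less[OF that(1), of q p] that(2,3)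
    by (cases p q rule: linorder_cases) auto
  have sorted: "sorted_wrt (<) ?s" "sorted_wrt (<) ?t" by simp_all
  have "i < i' \<longleftrightarrow> j < j'" if ij: "(i, j) \<in> order_match S T" and ij': "(i', j') \<in> order_match S T" for i j i' j'
  proof -
    have "\<exists>p<length ?s. ?s ! p = i \<and> ?t ! p = j"
      using ij unfolding order_match_def in_set_zip by auto
    then obtain p where p: "p < length ?s" "?s ! p = i" "?t ! p = j" by blast
    have "\<exists>q<length ?s. ?s ! q = i' \<and> ?t ! q = j'"
      using ij' unfolding order_match_def in_set_zip by auto
    then obtain q where q: "q < length ?s" "?s ! q = i'" "?t ! q = j'" by blast
    have "?s ! p < ?s ! q \<longleftrightarrow> p < q" by (rule mono[OF sorted(1) p(1) q(1)])
    moreover have "?t ! p < ?t ! q \<longleftrightarrow> p < q"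
      by (rule mono[OF sorted(2)]) (use p(1) q(1) len in linarith)+
    ultimately show ?thesis unfolding p q by simp
  qed
  moreover have "order_match S T \<subseteq> {1..N} \<times> {1..N}"
  proof -
    have "order_match S T \<subseteq> Domain (order_match S T) \<times> Range (order_match S T)" by auto
    also have "\<dots> \<subseteq> {1..N} \<times> {1..N}" unfolding D R using assms(1,2) by (rule Sigma_mono)
    finally show ?thesis .
  qed
  ultimately show O: "order_match S T \<in> order_rels N" by (rule order_relsI[rotated])
  show "card (order_match S T) = card S" using card_Domain_order_rel[OF O] D by simp
qed

text \<open>Listing the domain increasingly also lists the range increasingly, so domain and range
  determine an order-preserving partial injection.\<close>

lemma order_rel_eq_order_match:
  assumes R: "R \<in> order_rels N"
  shows "R = order_match (Domain R) (Range R)"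
proof -
  have "\<forall>i\<in>Domain R. \<exists>j. (i, j) \<in> R" by blast
  then obtain f where f: "\<And>i. i \<in> Domain R \<Longrightarrow> (i, f i) \<in> R" by metis
  have fin: "finite (Domain R)" "finite (Range R)"
    using finite_order_rel[OF R] by (auto simp: finite_Domain finite_Range)
  let ?s = "sorted_list_of_set (Domain R)"
  have Rf: "R = {(i, f i) | i. i \<in> Domain R}"
  proof (intro equalityI subsetI)
    fix x assume x: "x \<in> R"
    obtain i j where ij: "x = (i, j)" by (cases x)
    then have "j = f i" "i \<in> Domain R" using x f order_relsD(2)[OF R] by blast+
    then show "x \<in> {(i, f i) | i. i \<in> Domain R}" using ij by blast
  qed (use f in blast)
  then have "Range R = f ` Domain R" by blast
  moreover have "sorted_wrt (<) (map f ?s)"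
  proof -
    have "sorted_wrt (<) ?s" by (simp add: strict_sorted_iff)
    then show ?thesis unfolding sorted_wrt_map
    proof (rule sorted_wrt_mono_rel[rotated])
      fix x y assume xy: "x \<in> set ?s" "y \<in> set ?s" "x < y"
      then have "x \<in> Domain R" "y \<in> Domain R" using fin by simp_all
      then show "f x < f y" using order_relsD(1)[OF R f f] xy(3) by blast
    qed
  qed
  ultimately have "sorted_list_of_set (Range R) = map f ?s"
    using fin by (intro strict_sorted_equal) simp_all
  then have "order_match (Domain R) (Range R) = set (zip ?s (map f ?s))" by (simp add: order_match_def)
  also have "\<dots> = (\<lambda>i. (i, f i)) ` Domain R"
    using fin by (simp add: zip_map2 zip_same_conv_map)
  also have "\<dots> = R" using Rf by blast
  finally show ?thesis by simp
qed

text \<open>Both sides are order-preserving with domain \<open>S\<close> and range \<open>U\<close>.\<close>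

lemma order_match_comp:
  assumes "S \<subseteq> {1..N}" "T \<subseteq> {1..N}" "U \<subseteq> {1..N}" "card S = card T" "card T = card U"
  shows "order_match S T O order_match T U = order_match S U"
proof -
  let ?R = "order_match S T O order_match T U"
  have R: "?R \<in> order_rels N"
    using assms by (intro order_rels_comp order_match_order_rel) auto
  have "Domain (order_match S T) = S" "Range (order_match S T) = T" "Domain (order_match T U) = T" "Range (order_match T U) = U"
    using assms by (simp_all only: Domain_order_match Range_order_match)
  then have "Domain ?R = S" "Range ?R = U" by blast+
  then show ?thesis using order_rel_eq_order_match[OF R] by simp
qed

lemma order_match_Image:
  assumes "S \<subseteq> {1..N}" "T \<subseteq> {1..N}" "card S = card T"
  shows "order_match S T `` S = T"
  using Domain_order_match[OF assms] Range_order_match[OF assms] by blast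

text \<open>If no strand were lost, every point of \<open>T\<close> would have to lie in \<open>T'\<close>, which has the same size.\<close>

lemma card_order_match_comp_less:
  assumes "S \<subseteq> {1..N}" "T \<subseteq> {1..N}" "T' \<subseteq> {1..N}" "U \<subseteq> {1..N}"
    and "card S = k" "card T = k" "card T' = k" "card U = k" and "T \<noteq> T'"
  shows "card (order_match S T O order_match T' U) < k"
proof -
  let ?R = "order_match S T O order_match T' U"
  have R1: "order_match S T \<in> order_rels N" and R2: "order_match T' U \<in> order_rels N"
    using assms(1-8) by (auto intro!: order_match_order_rel)
  have R: "?R \<in> order_rels N" by (rule order_rels_comp[OF R1 R2])
  have c: "card S = card T" "card T' = card U" using assms(5-8) by simp_all
  have D: "Domain (order_match S T) = S" "Range (order_match S T) = T" "Domain (order_match T' U) = T'"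
    by (rule Domain_order_match[OF assms(1,2) c(1)] Range_order_match[OF assms(1,2) c(1)]
        Domain_order_match[OF assms(3,4) c(2)])+
  have fin: "finite S" "finite T" "finite T'"
    using assms(1-3) by (simp_all add: finite_subset[OF _ finite_atLeastAtMost])
  have "Domain ?R \<noteq> S"
  proof
    assume DS: "Domain ?R = S"
    have "T \<subseteq> T'"
    proof
      fix t assume "t \<in> T"
      then obtain s where s: "(s, t) \<in> order_match S T" using D(2) by blast
      then have "s \<in> S" using D(1) by blast
      then obtain u t' where "(s, t') \<in> order_match S T" "(t', u) \<in> order_match T' U" using DS by blast
      then show "t \<in> T'" using s order_relsD(2)[OF R1] D(3) by blast
    qed
    then show False using card_subset_eq[OF fin(3)] assms by auto
  qed
  moreover have "Domain ?R \<subseteq> S" using D(1) by blast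
  ultimately have "card (Domain ?R) < card S" using fin by (meson psubsetI psubset_card_mono)
  then show ?thesis using card_Domain_order_rel[OF R] assms by simp
qed

lemma strands_diagram_of: "strands (diagram_of N R) = R"
  by (auto simp: strands_def diagram_of_def doubleton_eq_iff)

lemma strands_planar_rook_diagram:
  assumes D: "D \<in> planar_rook_diagrams N"
  shows "strands D \<in> order_rels N" and "diagram_of N (strands D) = D"
proof -
  have P: "partition_on (points N) D"
    and B: "\<And>B. B \<in> D \<Longrightarrow> (\<exists>p. B = {p}) \<or> (\<exists>i j. B = {Top i, Bot j})"
    and pl: "planar D"
    using D by (auto simp: planar_rook_diagrams_def)
  have sub: "B \<subseteq> points N" if "B \<in> D" for B
    using P that by (auto simp: partition_on_def)
  have disj: "B = B'" if "B \<in> D" "B' \<in> D" "p \<in> B" "p \<in> B'" for B B' p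
    using P that by (meson disjointD disjoint_iff partition_on_def)
  have cov: "\<exists>B\<in>D. p \<in> B" if "p \<in> points N" for p
    using P that by (auto simp: partition_on_def)
  have bnd: "strands D \<subseteq> {1..N} \<times> {1..N}"
  proof
    fix x assume "x \<in> strands D"
    then obtain i j where x: "x = (i, j)" "{Top i, Bot j} \<in> D" by (auto simp: strands_def)
    from sub[OF this(2)] show "x \<in> {1..N} \<times> {1..N}" using x(1) by (auto simp: points_def)
  qed
  have eq: "i = i' \<longleftrightarrow> j = j'" if "(i, j) \<in> strands D" "(i', j') \<in> strands D" for i j i' j'
  proof -
    have "{Top i, Bot j} \<in> D" "{Top i', Bot j'} \<in> D" using that by (auto simp: strands_def)
    from disj[OF this, of "Top i"] disj[OF this, of "Bot j"] show ?thesis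
      by (auto simp: doubleton_eq_iff)
  qed
  have lt: "i < i' \<Longrightarrow> j < j'" if "(i, j) \<in> strands D" "(i', j') \<in> strands D" for i j i' j'
    using pl that unfolding planar_def by blast
  have "i < i' \<longleftrightarrow> j < j'" if "(i, j) \<in> strands D" "(i', j') \<in> strands D" for i j i' j'
    using eq[OF that] lt[OF that] lt[OF that(2,1)] by (metis linorder_neqE_nat order_less_asym)
  then show "strands D \<in> order_rels N" using bnd by (rule order_relsI[rotated])
  have single_Top: "{Top i} \<in> D \<longleftrightarrow> i \<in> {1..N} - Domain (strands D)" for i
  proof
    assume S: "{Top i} \<in> D"
    have "i \<in> {1..N}" using sub[OF S] by (auto simp: points_def)
    moreover have "{Top i, Bot j} \<notin> D" for j using disj[OF S, of "{Top i, Bot j}" "Top i"] by auto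
    ultimately show "i \<in> {1..N} - Domain (strands D)" by (auto simp: strands_def)
  next
    assume i: "i \<in> {1..N} - Domain (strands D)"
    then have "Top i \<in> points N" by (auto simp: points_def)
    then obtain C where C: "C \<in> D" "Top i \<in> C" using cov by blast
    then show "{Top i} \<in> D" using B[OF C(1)] i by (auto simp: strands_def)
  qed
  have single_Bot: "{Bot j} \<in> D \<longleftrightarrow> j \<in> {1..N} - Range (strands D)" for j
  proof
    assume S: "{Bot j} \<in> D"
    have "j \<in> {1..N}" using sub[OF S] by (auto simp: points_def)
    moreover have "{Top i, Bot j} \<notin> D" for i using disj[OF S, of "{Top i, Bot j}" "Bot j"] by auto
    ultimately show "j \<in> {1..N} - Range (strands D)" by (auto simp: strands_def)
  next
    assume j: "j \<in> {1..N} - Range (strands D)"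
    then have "Bot j \<in> points N" by (auto simp: points_def)
    then obtain C where C: "C \<in> D" "Bot j \<in> C" using cov by blast
    then show "{Bot j} \<in> D" using B[OF C(1)] j by (auto simp: strands_def)
  qed
  show "diagram_of N (strands D) = D"
  proof (intro equalityI subsetI)
    fix C assume "C \<in> diagram_of N (strands D)"
    then show "C \<in> D" using single_Top single_Bot
      by (auto simp: diagram_of_def) (auto simp: strands_def)
  next
    fix C assume C: "C \<in> D"
    consider i j where "C = {Top i, Bot j}" | i where "C = {Top i}" | j where "C = {Bot j}"
      using B[OF C] by (metis point.exhaust)
    then show "C \<in> diagram_of N (strands D)"
    proof cases
      case (1 i j)
      then have "(i, j) \<in> strands D" using C by (simp add: strands_def)
      then show ?thesis using 1 by (force simp: diagram_of_def)
    next
      case (2 i)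
      then have "i \<in> {1..N} - Domain (strands D)" using single_Top C by blast
      then show ?thesis using 2 unfolding diagram_of_def by blast
    next
      case (3 j)
      then have "j \<in> {1..N} - Range (strands D)" using single_Bot C by blast
      then show ?thesis using 3 unfolding diagram_of_def by blast
    qed
  qed
qed

lemma diagram_of_planar_rook:
  assumes R: "R \<in> order_rels N"
  shows "diagram_of N R \<in> planar_rook_diagrams N"
proof -
  note bnd = order_rels_bounded[OF R]
  have blk: "(\<exists>p. B = {p}) \<or> (\<exists>i j. B = {Top i, Bot j})" if "B \<in> diagram_of N R" for B
    using that by (auto simp: diagram_of_def)
  have "partition_on (points N) (diagram_of N R)"
  proof (rule partition_onI)
    show "{} \<notin> diagram_of N R" by (auto simp: diagram_of_def)
  next
    show "\<Union> (diagram_of N R) = points N"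
    proof (intro equalityI subsetI)
      fix p assume "p \<in> \<Union> (diagram_of N R)"
      then show "p \<in> points N" using bnd by (auto simp: diagram_of_def points_def)
    next
      fix p assume p: "p \<in> points N"
      show "p \<in> \<Union> (diagram_of N R)"
      proof (cases p)
        case (Top i)
        then have i: "i \<in> {1..N}" using p by (auto simp: points_def)
        show ?thesis
        proof (cases "i \<in> Domain R")
          case True
          then obtain j where "(i, j) \<in> R" by blast
          then have "{Top i, Bot j} \<in> diagram_of N R" by (force simp: diagram_of_def)
          then show ?thesis using Top by blast
        next
          case False
          then have "{Top i} \<in> diagram_of N R" using i by (simp add: diagram_of_def)
          then show ?thesis using Top by blast
        qed
      next
        case (Bot j)
        then have j: "j \<in> {1..N}" using p by (auto simp: points_def)
        show ?thesis
        proof (cases "j \<in> Range R")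
          case True
          then obtain i where "(i, j) \<in> R" by blast
          then have "{Top i, Bot j} \<in> diagram_of N R" by (force simp: diagram_of_def)
          then show ?thesis using Bot by blast
        next
          case False
          then have "{Bot j} \<in> diagram_of N R" using j by (simp add: diagram_of_def)
          then show ?thesis using Bot by blast
        qed
      qed
    qed
  next
    have top_block: "(\<exists>j. (i, j) \<in> R \<and> B = {Top i, Bot j}) \<or> i \<notin> Domain R \<and> B = {Top i}"
      if "B \<in> diagram_of N R" "Top i \<in> B" for B i
      using that by (auto simp: diagram_of_def)
    have bot_block: "(\<exists>i. (i, j) \<in> R \<and> B = {Top i, Bot j}) \<or> j \<notin> Range R \<and> B = {Bot j}"
      if "B \<in> diagram_of N R" "Bot j \<in> B" for B j
      using that by (auto simp: diagram_of_def)
    fix B C assume BC: "B \<in> diagram_of N R" "C \<in> diagram_of N R" "B \<noteq> C"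
    have False if x: "x \<in> B" "x \<in> C" for x
    proof (cases x)
      case (Top i)
      then show False
        using top_block[of B i] top_block[of C i] BC x order_relsD(2)[OF R] by blast
    next
      case (Bot j)
      then show False
        using bot_block[of B j] bot_block[of C j] BC x order_relsD(2)[OF R] by blast
    qed
    then show "disjnt B C" by (auto simp: disjnt_def)
  qed
  moreover have "planar (diagram_of N R)"
    unfolding planar_def strands_diagram_of using order_relsD(1)[OF R] by blast
  ultimately show ?thesis using blk by (auto simp: planar_rook_diagrams_def)
qed

lemma strands_stack: "strands (stack N a b) = strands a O strands b"
  by (simp add: stack_def strands_diagram_of)

section \<open>Linear algebra over the ground field\<close>

lemma subspace_module_vec_iff:
  "VectorSpace.subspace class_ring W (module_vec TYPE('k :: field) d) \<longleftrightarrow>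
     W \<subseteq> carrier_vec d \<and> 0\<^sub>v d \<in> W
     \<and> (\<forall>v\<in>W. \<forall>w\<in>W. v + w \<in> W) \<and> (\<forall>c. \<forall>v\<in>W. c \<cdot>\<^sub>v v \<in> W)"
  unfolding VectorSpace.subspace_def submodule_def
  using vec_vs[of d, where 'a='k] vec_module[of d, where 'a='k]
  by (auto simp: module_vec_simps)

text \<open>A nonzero column of each idempotent gives a family of vectors, and a row of each idempotent
  through a nonzero entry of that column gives functionals. The products of the idempotents show that
  the \<open>i\<close>-th functional vanishes on the \<open>j\<close>-th vector exactly when \<open>i \<noteq> j\<close>, so the vectors
  are linearly independent.\<close>

lemma orthogonal_idempotents_card_le:
  fixes E :: "'i \<Rightarrow> 'k :: field mat"
  assumes fin: "finite I"
    and E: "\<And>i. i \<in> I \<Longrightarrow> E i \<in> carrier_mat d d"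
    and idem: "\<And>i. i \<in> I \<Longrightarrow> E i * E i = E i"
    and nz: "\<And>i. i \<in> I \<Longrightarrow> E i \<noteq> 0\<^sub>m d d"
    and orth: "\<And>i j. i \<in> I \<Longrightarrow> j \<in> I \<Longrightarrow> i \<noteq> j \<Longrightarrow> E i * E j = 0\<^sub>m d d"
  shows "card I \<le> d"
proof -
  interpret V: vec_space "TYPE('k)" d .
  have "\<exists>r c. r < d \<and> c < d \<and> E i $$ (r, c) \<noteq> 0" if "i \<in> I" for i
    using nz[OF that] E[OF that] by (metis carrier_matD eq_matI index_zero_mat)
  then obtain r c where rc: "\<And>i. i \<in> I \<Longrightarrow> r i < d \<and> c i < d \<and> E i $$ (r i, c i) \<noteq> 0"
    by metis
  define v where "v i = col (E i) (c i)" for i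
  define f where "f i = row (E i) (r i)" for i
  have v_carrier: "v i \<in> carrier_vec d" and f_carrier: "f i \<in> carrier_vec d" if "i \<in> I" for i
    using E[OF that] by (auto simp: v_def f_def)
  have entry: "v j \<bullet> f i = (E i * E j) $$ (r i, c j)" if "i \<in> I" "j \<in> I" for i j
  proof -
    have "v j \<bullet> f i = f i \<bullet> v j"
      using v_carrier f_carrier that by (intro comm_scalar_prod)
    also have "\<dots> = (E i * E j) $$ (r i, c j)"
      using E[OF that(1)] E[OF that(2)] rc[OF that(1)] rc[OF that(2)] by (simp add: v_def f_def)
    finally show ?thesis .
  qed
  have diag: "v i \<bullet> f i \<noteq> 0" if "i \<in> I" for i
    using entry[OF that that] idem rc that by simp
  have off: "v j \<bullet> f i = 0" if "i \<in> I" "j \<in> I" "i \<noteq> j" for i j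
    using entry[OF that(1,2)] orth[OF that] rc that by simp
  have inj: "inj_on v I"
    using diag off by (metis inj_onI)
  have car: "v ` I \<subseteq> carrier_vec d" using v_carrier by blast
  have "V.lin_indpt (v ` I)"
  proof (rule V.finite_lin_indpt2)
    fix a :: "'k vec \<Rightarrow> 'k" assume 0: "V.lincomb a (v ` I) = 0\<^sub>v d"
    show "\<forall>w\<in>v ` I. a w = 0"
    proof
      fix w assume "w \<in> v ` I"
      then obtain i where i: "i \<in> I" "w = v i" by blast
      have "0 = V.lincomb a (v ` I) \<bullet> f i" using 0 f_carrier[OF i(1)] by simp
      also have "\<dots> = (\<Sum>u\<in>v ` I. (a u \<cdot>\<^sub>v u) \<bullet> f i)"
        unfolding V.lincomb_def using car f_carrier[OF i(1)]
        by (intro V.finsum_scalar_prod_sum) auto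
      also have "\<dots> = (\<Sum>j\<in>I. a (v j) * (v j \<bullet> f i))"
        using v_carrier f_carrier[OF i(1)] by (simp add: sum.reindex[OF inj] cong: sum.cong)
      also have "\<dots> = a (v i) * (v i \<bullet> f i)"
      proof -
        have "a (v j) * (v j \<bullet> f i) = 0" if "j \<in> I - {i}" for j
          using off[OF i(1), of j] that by auto
        then have "(\<Sum>j\<in>I - {i}. a (v j) * (v j \<bullet> f i)) = 0" by (intro sum.neutral) blast
        then show ?thesis by (simp add: sum.remove[OF fin i(1)])
      qed
      finally show "a w = 0" using diag[OF i(1)] i(2) by simp
    qed
  qed (use fin car in auto)
  then have "card (v ` I) \<le> d"
    using V.li_le_dim(2)[OF V.fin_dim _ _] car V.dim_is_n by simp
  then show ?thesis using card_image[OF inj] by simp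
qed

text \<open>When all matrices are scalar, every line is a subrepresentation.\<close>

lemma simple_scalar_representation_dim:
  fixes \<rho> :: "'a \<Rightarrow> 'k :: field mat"
  assumes simple: "simple_representation M d \<rho>"
    and scalar: "\<And>x. x \<in> carrier M \<Longrightarrow> \<rho> x = 0\<^sub>m d d \<or> \<rho> x = 1\<^sub>m d"
  shows "d = 1"
proof (rule ccontr)
  assume "d \<noteq> 1"
  then have d: "d > 1" using simple by (auto simp: simple_representation_def)
  define W :: "'k vec set" where "W = {v \<in> carrier_vec d. \<forall>i<d. i \<noteq> 0 \<longrightarrow> v $ i = 0}"
  have "VectorSpace.subspace class_ring W (module_vec TYPE('k) d)"
    unfolding subspace_module_vec_iff by (auto simp: W_def)
  moreover have "\<forall>x\<in>carrier M. \<forall>w\<in>W. \<rho> x *\<^sub>v w \<in> W"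
  proof (intro ballI)
    fix x w assume "x \<in> carrier M" "w \<in> W"
    moreover from this have "0\<^sub>m d d *\<^sub>v w = 0\<^sub>v d" by (intro eq_vecI) (auto simp: W_def)
    ultimately show "\<rho> x *\<^sub>v w \<in> W" using scalar[of x] by (auto simp: W_def)
  qed
  ultimately have "W = {0\<^sub>v d} \<or> W = carrier_vec d"
    using simple by (auto simp: simple_representation_def)
  moreover have "unit_vec d 0 \<in> W" using d by (auto simp: W_def)
  moreover have "unit_vec d 0 \<noteq> (0\<^sub>v d :: 'k vec)"
  proof
    assume "unit_vec d 0 = (0\<^sub>v d :: 'k vec)"
    then have "unit_vec d 0 $ 0 = (0\<^sub>v d :: 'k vec) $ 0" by simp
    then show False using d by simp
  qed
  moreover have "unit_vec d 1 \<notin> W" using d by (auto simp: W_def)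
  ultimately show False by auto
qed

section \<open>Representations of truncated diagram monoids\<close>

text \<open>With the identity diagram outside the window the unit is adjoined. Then no product of diagrams
  is the unit, which separates the units of the truncation from its diagrams.\<close>

lemma truncation_simps:
  assumes "\<not> (a \<le> real (num_strands \<one>\<^bsub>M\<^esub>) \<and> real (num_strands \<one>\<^bsub>M\<^esub>) \<le> b)"
  shows "x \<in> carrier (truncation a b M) \<longleftrightarrow>
      (\<exists>D\<in>carrier M. x = Diag D \<and> a \<le> real (num_strands D) \<and> real (num_strands D) \<le> b)
      \<or> x = Zero \<and> (\<exists>D\<in>carrier M. real (num_strands D) < a) \<or> x = Unit"
    and "mult (truncation a b M) = trunc_mult a M"
    and "one (truncation a b M) = Unit"
  using assms by (auto simp: truncation_def Let_def)

lemma trunc_mult_Zero: "trunc_mult a M x Zero = Zero" "trunc_mult a M Zero x = Zero"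
  by (cases x; simp)+

lemma trunc_mult_eq_Unit: "trunc_mult a M x y = Unit \<longleftrightarrow> x = Unit \<and> y = Unit"
  by (cases x; cases y) auto

text \<open>The action on row vectors indexed by the subsets in \<open>Ss\<close>: a diagram sends a subset to its image
  when all points of the subset are top ends of strands, and to \<open>0\<close> otherwise.\<close>

primrec subset_rep :: "nat set list \<Rightarrow> point set set truncated \<Rightarrow> 'k :: field mat" where
  "subset_rep Ss (Diag D) = mat (length Ss) (length Ss) (\<lambda>(p, q).
     of_bool (Ss ! p \<subseteq> Domain (strands D) \<and> strands D `` (Ss ! p) = Ss ! q))"
| "subset_rep Ss Zero = 0\<^sub>m (length Ss) (length Ss)"
| "subset_rep Ss Unit = 1\<^sub>m (length Ss)"

lemma subset_rep_carrier [simp]: "subset_rep Ss x \<in> carrier_mat (length Ss) (length Ss)"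
  by (cases x) auto

text \<open>Row \<open>p\<close> of the first factor has at most one nonzero entry, at the image of the \<open>p\<close>-th subset;
  this image is again listed in \<open>Ss\<close>, since the strands of \<open>c\<close> do not leave \<open>X\<close> and preserve
  cardinality. So the sum defining the matrix product collapses to one term.\<close>

lemma subset_rep_mult:
  fixes Ss :: "nat set list"
  assumes Ss: "distinct Ss" "set Ss = {S. S \<subseteq> X \<and> card S = k}"
    and c: "strands c \<in> order_rels N" and d: "strands d \<in> order_rels N"
    and inv: "\<And>i j. (i, j) \<in> strands c \<Longrightarrow> i \<in> X \<Longrightarrow> j \<in> X"
  shows "subset_rep Ss (Diag (stack N c d)) = subset_rep Ss (Diag c) * (subset_rep Ss (Diag d) :: 'k :: field mat)"
proof (rule eq_matI)
  fix p q assume "p < dim_row (subset_rep Ss (Diag c) * (subset_rep Ss (Diag d) :: 'k mat))"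
    "q < dim_col (subset_rep Ss (Diag c) * (subset_rep Ss (Diag d) :: 'k mat))"
  then have pq: "p < length Ss" "q < length Ss" by auto
  let ?l = "length Ss" and ?C = "strands c" and ?D = "strands d"
  let ?A = "\<lambda>t. ?C `` (Ss ! p) = Ss ! t"
  let ?P = "Ss ! p \<subseteq> Domain ?C"
  have sv: "single_valued ?C" by (rule order_rels_single_valued[OF c])
  have Sp: "Ss ! p \<subseteq> X" "card (Ss ! p) = k" using Ss(2) nth_mem[OF pq(1)] by auto
  have "(subset_rep Ss (Diag c) * (subset_rep Ss (Diag d) :: 'k mat)) $$ (p, q)
      = (\<Sum>t<?l. of_bool (?P \<and> ?A t) * of_bool (Ss ! t \<subseteq> Domain ?D \<and> ?D `` (Ss ! t) = Ss ! q))"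
    using pq by (simp add: scalar_prod_def atLeast0LessThan)
  also have "\<dots> = of_bool (Ss ! p \<subseteq> Domain (?C O ?D) \<and> (?C O ?D) `` (Ss ! p) = Ss ! q)"
  proof (cases "?P")
    case True
    have "?C `` (Ss ! p) \<in> set Ss"
      using Ss(2) Sp inv card_Image_order_rel[OF c True] by auto
    then obtain t where t: "t < ?l" "Ss ! t = ?C `` (Ss ! p)" by (metis in_set_conv_nth)
    have At: "?A s \<longleftrightarrow> s = t" if "s < ?l" for s
      using t that Ss(1) by (metis nth_eq_iff_index_eq)
    have "(\<Sum>s<?l. of_bool (?P \<and> ?A s) * (of_bool (Ss ! s \<subseteq> Domain ?D \<and> ?D `` (Ss ! s) = Ss ! q) :: 'k))
       = (\<Sum>s<?l. if s = t then of_bool (Ss ! t \<subseteq> Domain ?D \<and> ?D `` (Ss ! t) = Ss ! q) else 0)"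
      by (rule sum.cong) (use True At in auto)
    also have "\<dots> = of_bool (Ss ! t \<subseteq> Domain ?D \<and> ?D `` (Ss ! t) = Ss ! q)"
      using t(1) by simp
    also have "Ss ! t \<subseteq> Domain ?D \<longleftrightarrow> Ss ! p \<subseteq> Domain (?C O ?D)"
    proof
      assume "Ss ! t \<subseteq> Domain ?D"
      then show "Ss ! p \<subseteq> Domain (?C O ?D)" using True t(2) by blast
    next
      assume a: "Ss ! p \<subseteq> Domain (?C O ?D)"
      show "Ss ! t \<subseteq> Domain ?D"
      proof
        fix y assume "y \<in> Ss ! t"
        then obtain x where x: "x \<in> Ss ! p" "(x, y) \<in> ?C" using t(2) by blast
        then obtain y' z where "(x, y') \<in> ?C" "(y', z) \<in> ?D" using a by blast
        then show "y \<in> Domain ?D" using x sv by (metis DomainI single_valuedD)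
      qed
    qed
    also have "?D `` (Ss ! t) = (?C O ?D) `` (Ss ! p)" using t(2) by blast
    finally show ?thesis .
  next
    case False
    then have "\<not> Ss ! p \<subseteq> Domain (?C O ?D)" by blast
    then show ?thesis using False by simp
  qed
  finally show "subset_rep Ss (Diag (stack N c d)) $$ (p, q)
      = (subset_rep Ss (Diag c) * (subset_rep Ss (Diag d) :: 'k mat)) $$ (p, q)"
    using pq by (simp add: strands_stack)
qed auto

text \<open>This makes the action compatible with collapsing products of low rank to the adjoined zero.\<close>

lemma subset_rep_low_rank:
  assumes Ss: "set Ss \<subseteq> {S. card S = k}" and c: "strands c \<in> order_rels N" and "num_strands c < k"
  shows "subset_rep Ss (Diag c) = 0\<^sub>m (length Ss) (length Ss)"
proof -
  have "\<not> S \<subseteq> Domain (strands c)" if "S \<in> set Ss" for S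
  proof
    assume "S \<subseteq> Domain (strands c)"
    then have "card S \<le> card (Domain (strands c))"
      using finite_order_rel[OF c] by (intro card_mono) (auto simp: finite_Domain)
    then show False using card_Domain_order_rel[OF c] assms that by (auto simp: num_strands_def)
  qed
  then show ?thesis by (intro eq_matI) auto
qed

lemma binomial_ge_2: "0 < k \<Longrightarrow> k < n \<Longrightarrow> 2 \<le> n choose k"
proof -
  assume k: "0 < k" "k < n"
  then obtain m l where ml: "n = Suc m" "k = Suc l" by (metis gr0_implies_Suc less_trans)
  have "0 < m choose l" "0 < m choose Suc l" using k ml by (simp_all add: zero_less_binomial)
  then have "2 \<le> (m choose l) + (m choose Suc l)" by linarith
  then show ?thesis using ml by simp
qed

text \<open>A diagram of rank \<open>k\<close> with ends \<open>S\<close> and \<open>U\<close> in \<open>X\<close> acts as the matrix unit at \<open>(S, U)\<close>, because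
  \<open>S\<close> is the only \<open>k\<close>-element set contained in its domain. All matrix units occur, so
  a nonzero invariant subspace contains all unit vectors. Both trivial representations have
  dimension one, while \<open>card X choose k\<close> is at least two.\<close>

lemma subset_rep_simple:
  fixes a b :: real and M :: "point set set monoid"
  assumes mult: "mult M = stack N" and C: "carrier M \<subseteq> planar_rook_diagrams N"
    and X: "X \<subseteq> {1..N}"
    and inv: "\<And>D i j. D \<in> carrier M \<Longrightarrow> (i, j) \<in> strands D \<Longrightarrow> i \<in> X \<Longrightarrow> j \<in> X"
    and full: "\<And>S T. S \<subseteq> X \<Longrightarrow> T \<subseteq> X \<Longrightarrow> card S = k \<Longrightarrow> card T = k
      \<Longrightarrow> diagram_of N (order_match S T) \<in> carrier M"
    and k: "a \<le> real k" "real k \<le> b" "0 < k" "k < card X"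
    and one: "\<not> (a \<le> real (num_strands \<one>\<^bsub>M\<^esub>) \<and> real (num_strands \<one>\<^bsub>M\<^esub>) \<le> b)"
  shows "\<exists>\<rho> :: point set set truncated \<Rightarrow> 'k :: field mat.
    simple_representation (truncation a b M) (card X choose k) \<rho>
    \<and> \<not> trivial_representation (truncation a b M) (card X choose k) \<rho>"
proof -
  let ?T = "truncation a b M"
  note T = truncation_simps[OF one]
  have finX: "finite X" using X by (rule finite_subset) simp
  then obtain Ss where Ss: "distinct Ss" "set Ss = {S. S \<subseteq> X \<and> card S = k}"
    using finite_distinct_list[of "{S. S \<subseteq> X \<and> card S = k}"] by auto
  let ?l = "length Ss"
  have l: "?l = card X choose k"
    using distinct_card[OF Ss(1)] Ss(2) n_subsets[OF finX] by simp
  define \<rho> :: "point set set truncated \<Rightarrow> 'k mat" where "\<rho> = subset_rep Ss"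
  have ord: "strands D \<in> order_rels N" if "D \<in> carrier M" for D
    using C that strands_planar_rook_diagram by blast
  have hom: "\<rho> (trunc_mult a M x y) = \<rho> x * \<rho> y" if x: "x \<in> carrier ?T" and y: "y \<in> carrier ?T" for x y
  proof (cases x)
    case Zero
    then show ?thesis by (simp add: trunc_mult_Zero \<rho>_def left_mult_zero_mat[OF subset_rep_carrier])
  next
    case Unit
    then show ?thesis by (simp add: \<rho>_def left_mult_one_mat[OF subset_rep_carrier])
  next
    case c: (Diag c)
    show ?thesis
    proof (cases y)
      case Zero
      then show ?thesis
        by (simp add: trunc_mult_Zero \<rho>_def c right_mult_zero_mat[OF subset_rep_carrier])
    next
      case Unit
      then show ?thesis by (simp add: c \<rho>_def right_mult_one_mat[OF subset_rep_carrier])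
    next
      case d: (Diag d)
      have cd: "c \<in> carrier M" "d \<in> carrier M" using x y c d T(1) by auto
      have prod: "\<rho> (Diag (stack N c d)) = \<rho> x * \<rho> y"
        unfolding \<rho>_def c d by (rule subset_rep_mult[OF Ss ord ord inv]) (use cd in auto)
      have o: "strands (stack N c d) \<in> order_rels N"
        using order_rels_comp[OF ord ord] cd by (simp add: strands_stack)
      show ?thesis
      proof (cases "real (num_strands (stack N c d)) < a")
        case True
        then have "num_strands (stack N c d) < k" using k by linarith
        then have "\<rho> (Diag (stack N c d)) = 0\<^sub>m ?l ?l"
          unfolding \<rho>_def using Ss(2) o by (intro subset_rep_low_rank) auto
        then show ?thesis using prod True by (simp add: c d mult \<rho>_def)
      next
        case False
        then show ?thesis using prod by (simp add: c d mult)
      qed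
    qed
  qed
  have rep: "representation ?T ?l \<rho>"
    unfolding representation_def T(2,3) using hom by (auto simp: \<rho>_def)
  have unit: "\<exists>x\<in>carrier ?T. \<rho> x = mat ?l ?l (\<lambda>(r, s). of_bool (r = p \<and> s = q))"
    if pq: "p < ?l" "q < ?l" for p q
  proof -
    let ?S = "Ss ! p" and ?U = "Ss ! q"
    have SU: "?S \<subseteq> X" "?U \<subseteq> X" "card ?S = k" "card ?U = k"
      using Ss(2) nth_mem[OF pq(1)] nth_mem[OF pq(2)] by auto
    then have SN: "?S \<subseteq> {1..N}" "?U \<subseteq> {1..N}" "card ?S = card ?U" using X by auto
    let ?D = "diagram_of N (order_match ?S ?U)"
    have "num_strands ?D = k"
      using card_order_match[OF SN] SU by (simp add: num_strands_def strands_diagram_of)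
    then have "Diag ?D \<in> carrier ?T" using full[OF SU] k T(1) by auto
    moreover have "\<rho> (Diag ?D) = mat ?l ?l (\<lambda>(r, s). of_bool (r = p \<and> s = q))"
    proof (rule eq_matI)
      fix r s assume "r < dim_row (mat ?l ?l (\<lambda>(r, s). of_bool (r = p \<and> s = q) :: 'k))"
        "s < dim_col (mat ?l ?l (\<lambda>(r, s). of_bool (r = p \<and> s = q) :: 'k))"
      then have rs: "r < ?l" "s < ?l" by auto
      have "finite ?S" using SU(1) finX finite_subset by blast
      moreover have "card (Ss ! r) = k" using Ss(2) nth_mem[OF rs(1)] by auto
      ultimately have "Ss ! r \<subseteq> ?S \<longleftrightarrow> Ss ! r = ?S"
        using SU by (metis card_subset_eq subset_refl)
      then have 1: "Ss ! r \<subseteq> ?S \<longleftrightarrow> r = p"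
        using nth_eq_iff_index_eq[OF Ss(1) rs(1) pq(1)] by simp
      have "order_match ?S ?U `` ?S = Ss ! s \<longleftrightarrow> s = q"
        using order_match_Image[OF SN] nth_eq_iff_index_eq[OF Ss(1) rs(2) pq(2)] by auto
      then show "\<rho> (Diag ?D) $$ (r, s) = mat ?l ?l (\<lambda>(r, s). of_bool (r = p \<and> s = q)) $$ (r, s)"
        using rs 1 Domain_order_match[OF SN] by (auto simp: \<rho>_def strands_diagram_of)
    qed (auto simp: \<rho>_def)
    ultimately show ?thesis by blast
  qed
  have d2: "?l \<ge> 2" using binomial_ge_2[OF k(3,4)] l by simp
  have "W = {0\<^sub>v ?l} \<or> W = carrier_vec ?l"
    if sub: "VectorSpace.subspace class_ring W (module_vec TYPE('k) ?l)"
      and invW: "\<forall>x\<in>carrier ?T. \<forall>w\<in>W. \<rho> x *\<^sub>v w \<in> W" for W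
  proof (cases "W \<subseteq> {0\<^sub>v ?l}")
    case True
    then show ?thesis using sub by (auto simp: subspace_module_vec_iff)
  next
    case False
    have W: "W \<subseteq> carrier_vec ?l" "0\<^sub>v ?l \<in> W" "\<And>v w. v \<in> W \<Longrightarrow> w \<in> W \<Longrightarrow> v + w \<in> W"
      "\<And>c v. v \<in> W \<Longrightarrow> c \<cdot>\<^sub>v v \<in> W"
      using sub by (auto simp: subspace_module_vec_iff)
    from False obtain w where w: "w \<in> W" "w \<noteq> 0\<^sub>v ?l" by blast
    have wc: "w \<in> carrier_vec ?l" using W(1) w(1) by blast
    then obtain q where q: "q < ?l" "w $ q \<noteq> 0"
      using w(2) by (metis carrier_vecD eq_vecI index_zero_vec)
    have units: "unit_vec ?l p \<in> W" if p: "p < ?l" for p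
    proof -
      obtain x where x: "x \<in> carrier ?T" "\<rho> x = mat ?l ?l (\<lambda>(r, s). of_bool (r = p \<and> s = q))"
        using unit[OF p q(1)] by blast
      have "\<rho> x *\<^sub>v w = w $ q \<cdot>\<^sub>v unit_vec ?l p"
      proof (rule eq_vecI)
        fix i assume "i < dim_vec (w $ q \<cdot>\<^sub>v unit_vec ?l p)"
        then have i: "i < ?l" by simp
        have "(\<rho> x *\<^sub>v w) $ i = (\<Sum>s<?l. of_bool (i = p \<and> s = q) * w $ s)"
          using i wc by (simp add: x(2) scalar_prod_def atLeast0LessThan)
        also have "\<dots> = (\<Sum>s<?l. if s = q then of_bool (i = p) * w $ q else 0)"
          by (rule sum.cong) auto
        also have "\<dots> = of_bool (i = p) * w $ q" using q(1) by simp
        finally show "(\<rho> x *\<^sub>v w) $ i = (w $ q \<cdot>\<^sub>v unit_vec ?l p) $ i"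
          using i p by simp
      qed (simp add: x(2))
      then have "w $ q \<cdot>\<^sub>v unit_vec ?l p \<in> W" using invW x(1) w(1) by metis
      from W(4)[OF this, of "inverse (w $ q)"] show ?thesis
        using q(2) by (simp add: smult_smult_assoc)
    qed
    have "v \<in> W" if v: "v \<in> carrier_vec ?l" for v
    proof -
      have "vec ?l (\<lambda>i. if i < m then v $ i else 0) \<in> W" if "m \<le> ?l" for m
        using that
      proof (induction m)
        case 0
        have "vec ?l (\<lambda>i. if i < 0 then v $ i else 0) = 0\<^sub>v ?l" by auto
        then show ?case using W(2) by simp
      next
        case (Suc m)
        have "vec ?l (\<lambda>i. if i < Suc m then v $ i else 0)
          = vec ?l (\<lambda>i. if i < m then v $ i else 0) + v $ m \<cdot>\<^sub>v unit_vec ?l m"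
          using Suc.prems by (intro eq_vecI) (auto simp: less_Suc_eq)
        then show ?case using W(3)[OF Suc.IH W(4)[OF units]] Suc.prems by simp
      qed
      from this[of ?l] have "vec ?l (\<lambda>i. if i < ?l then v $ i else 0) \<in> W" by simp
      moreover have "vec ?l (\<lambda>i. if i < ?l then v $ i else 0) = v" using v by (intro eq_vecI) auto
      ultimately show ?thesis by simp
    qed
    then show ?thesis using W(1) by blast
  qed
  then have "simple_representation ?T ?l \<rho>"
    using rep d2 unfolding simple_representation_def by auto
  moreover have "\<not> trivial_representation ?T ?l \<rho>"
    using d2 by (auto simp: trivial_representation_def isomorphic_representations_def)
  ultimately show ?thesis using l by metis
qed


text \<open>A diagram of least rank \<open>k\<close> among those with nonzero matrix factors through the identity
  diagram of every \<open>k\<close>-element subset, so none of these idempotents acts as \<open>0\<close>; products of two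
  different ones do, by minimality of \<open>k\<close>. As \<open>a\<close> is positive, the empty diagram is cut off and a
  zero is adjoined.\<close>

lemma nontrivial_simple_dim_ge:
  fixes a b :: real and M :: "point set set monoid" and \<rho> :: "point set set truncated \<Rightarrow> 'k :: field mat"
  assumes mult: "mult M = stack N" and C: "carrier M = planar_rook_diagrams N"
    and a: "0 < a"
    and one: "\<not> (a \<le> real (num_strands \<one>\<^bsub>M\<^esub>) \<and> real (num_strands \<one>\<^bsub>M\<^esub>) \<le> b)"
    and simple: "simple_representation (truncation a b M) d \<rho>"
    and nontriv: "\<not> trivial_representation (truncation a b M) d \<rho>"
  shows "\<exists>k. a \<le> real k \<and> real k \<le> b \<and> (N choose k) \<le> d"
proof -
  let ?T = "truncation a b M"
  note T = truncation_simps[OF one]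
  have rep: "\<And>x. x \<in> carrier ?T \<Longrightarrow> \<rho> x \<in> carrier_mat d d" "\<rho> Unit = 1\<^sub>m d"
    "\<And>x y. x \<in> carrier ?T \<Longrightarrow> y \<in> carrier ?T \<Longrightarrow> \<rho> (trunc_mult a M x y) = \<rho> x * \<rho> y"
    and simp_sub: "\<And>W. VectorSpace.subspace class_ring W (module_vec TYPE('k) d) \<Longrightarrow>
      \<forall>x\<in>carrier ?T. \<forall>w\<in>W. \<rho> x *\<^sub>v w \<in> W \<Longrightarrow> W = {0\<^sub>v d} \<or> W = carrier_vec d"
    using simple by (auto simp: simple_representation_def representation_def T)
  have triv: False if "d = 1" "\<And>x. x \<in> carrier ?T \<Longrightarrow> \<rho> x = \<rho>' x"
    "\<rho>' = (\<lambda>x. if x \<in> Units ?T then 1\<^sub>m 1 else 0\<^sub>m 1 1) \<or> \<rho>' = (\<lambda>x. 1\<^sub>m 1)" for \<rho>'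
  proof -
    have inv: "invertible_mat (1\<^sub>m 1 :: 'k mat)"
      by (auto simp: invertible_mat_def inverts_mat_def intro!: exI[of _ "1\<^sub>m 1"])
    have "isomorphic_representations ?T d \<rho> 1 \<rho>'"
      unfolding isomorphic_representations_def
    proof (intro conjI bexI[of _ "1\<^sub>m 1"] ballI)
      fix x assume "x \<in> carrier ?T"
      then show "1\<^sub>m 1 * \<rho> x = \<rho>' x * 1\<^sub>m 1" using rep(1)[of x] that(1,2) by auto
    qed (use that(1) inv in auto)
    then show False using nontriv that(3) by (auto simp: trivial_representation_def)
  qed
  have empty: "{} \<in> order_rels N" by (simp add: order_rels_def)
  then have Z: "Zero \<in> carrier ?T"
    using T(1) a diagram_of_planar_rook[OF empty] C
    by (auto simp: num_strands_def strands_diagram_of intro!: bexI[of _ "diagram_of N {}"])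
  have U: "Unit \<in> carrier ?T" using T(1) by simp
  have Pc: "\<rho> Zero \<in> carrier_mat d d" by (rule rep(1)[OF Z])
  have absorb: "\<rho> Zero * \<rho> x = \<rho> Zero" "\<rho> x * \<rho> Zero = \<rho> Zero" if "x \<in> carrier ?T" for x
    using rep(3)[OF that Z] rep(3)[OF Z that] by (simp_all add: trunc_mult_Zero)
  \<comment> \<open>The kernel of the zero is invariant because zero absorbs every element.\<close>
  define W where "W = {v \<in> carrier_vec d. \<rho> Zero *\<^sub>v v = 0\<^sub>v d}"
  have "VectorSpace.subspace class_ring W (module_vec TYPE('k) d)"
    unfolding subspace_module_vec_iff W_def using Pc
    by (auto simp: mult_add_distrib_mat_vec[of _ d d] mult_mat_vec[of _ d d])
  moreover have "\<forall>x\<in>carrier ?T. \<forall>w\<in>W. \<rho> x *\<^sub>v w \<in> W"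
  proof (intro ballI)
    fix x w assume x: "x \<in> carrier ?T" and w: "w \<in> W"
    have "\<rho> Zero *\<^sub>v (\<rho> x *\<^sub>v w) = (\<rho> Zero * \<rho> x) *\<^sub>v w"
      using Pc rep(1)[OF x] w by (auto simp: W_def assoc_mult_mat_vec[of _ d d _ d])
    then show "\<rho> x *\<^sub>v w \<in> W" using w rep(1)[OF x] absorb(1)[OF x] by (auto simp: W_def)
  qed
  ultimately have "W = {0\<^sub>v d} \<or> W = carrier_vec d" by (rule simp_sub)
  then have P0: "\<rho> Zero = 0\<^sub>m d d"
  proof
    assume W0: "W = {0\<^sub>v d}"
    have fixed: "\<rho> Zero *\<^sub>v v = v" if v: "v \<in> carrier_vec d" for v
    proof -
      have Pv: "\<rho> Zero *\<^sub>v v \<in> carrier_vec d" using Pc v by simp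
      have "\<rho> Zero *\<^sub>v (v - \<rho> Zero *\<^sub>v v) = \<rho> Zero *\<^sub>v v - (\<rho> Zero * \<rho> Zero) *\<^sub>v v"
        using Pc v Pv by (simp add: mult_minus_distrib_mat_vec[of _ d d] assoc_mult_mat_vec[of _ d d _ d])
      also have "\<dots> = 0\<^sub>v d" using absorb(1)[OF Z] Pv by simp
      finally have "v - \<rho> Zero *\<^sub>v v \<in> W" using v Pv by (simp add: W_def)
      then have 0: "v - \<rho> Zero *\<^sub>v v = 0\<^sub>v d" using W0 by simp
      show ?thesis
      proof (rule eq_vecI)
        fix i assume "i < dim_vec v"
        then show "(\<rho> Zero *\<^sub>v v) $ i = v $ i"
          using arg_cong[OF 0, of "\<lambda>u. u $ i"] v Pv Pc by simp
      qed (use v Pc in simp)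
    qed
    have P1: "\<rho> Zero = 1\<^sub>m d"
    proof (rule eq_matI)
      fix i j assume ij: "i < dim_row (1\<^sub>m d :: 'k mat)" "j < dim_col (1\<^sub>m d :: 'k mat)"
      have "\<rho> Zero $$ (i, j) = (\<rho> Zero *\<^sub>v unit_vec d j) $ i"
        using ij Pc by (auto simp: row_def)
      also have "\<dots> = 1\<^sub>m d $$ (i, j)" using ij by (simp add: fixed)
      finally show "\<rho> Zero $$ (i, j) = 1\<^sub>m d $$ (i, j)" .
    qed (use Pc in auto)
    have all1: "\<rho> x = 1\<^sub>m d" if "x \<in> carrier ?T" for x
      using absorb(2)[OF that] rep(1)[OF that] P1 by simp
    then have "d = 1" using simple_scalar_representation_dim[OF simple] by blast
    then show ?thesis using triv[of "\<lambda>x. 1\<^sub>m 1"] all1 by blast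
  next
    assume "W = carrier_vec d"
    then have "unit_vec d j \<in> W" for j by simp
    then have 0: "\<rho> Zero *\<^sub>v unit_vec d j = 0\<^sub>v d" for j unfolding W_def by blast
    show ?thesis
    proof (rule eq_matI)
      fix i j assume ij: "i < dim_row (0\<^sub>m d d :: 'k mat)" "j < dim_col (0\<^sub>m d d :: 'k mat)"
      have "\<rho> Zero $$ (i, j) = (\<rho> Zero *\<^sub>v unit_vec d j) $ i"
        using ij Pc by (auto simp: row_def)
      then show "\<rho> Zero $$ (i, j) = 0\<^sub>m d d $$ (i, j)" using ij 0 by simp
    qed (use Pc in auto)
  qed
  have "\<exists>D. Diag D \<in> carrier ?T \<and> \<rho> (Diag D) \<noteq> 0\<^sub>m d d"
  proof (rule ccontr)
    assume "\<not> ?thesis"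
    then have val: "\<rho> x = (if x = Unit then 1\<^sub>m d else 0\<^sub>m d d)" if "x \<in> carrier ?T" for x
      using that P0 rep(2) by (cases x) auto
    then have d1: "d = 1" using simple_scalar_representation_dim[OF simple] by metis
    have units: "x \<in> Units ?T \<longleftrightarrow> x = Unit" if "x \<in> carrier ?T" for x
      unfolding Units_def T(2,3) trunc_mult_eq_Unit using U by auto
    show False
      by (rule triv[OF d1 _ disjI1[OF refl]]) (use val units d1 in simp)
  qed
  then obtain D0 where D0: "Diag D0 \<in> carrier ?T" "\<rho> (Diag D0) \<noteq> 0\<^sub>m d d"
    and least: "\<And>D. Diag D \<in> carrier ?T \<Longrightarrow> num_strands D < num_strands D0 \<Longrightarrow> \<rho> (Diag D) = 0\<^sub>m d d"
    using ex_has_least_nat[of "\<lambda>D. Diag D \<in> carrier ?T \<and> \<rho> (Diag D) \<noteq> 0\<^sub>m d d" _ num_strands]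
    by (metis not_le)
  define k where "k = num_strands D0"
  have k: "a \<le> real k" "real k \<le> b" and D0M: "D0 \<in> planar_rook_diagrams N"
    using D0(1) T(1) C by (auto simp: k_def)
  define I where "I = {S. S \<subseteq> {1..N} \<and> card S = k}"
  define e where "e S U = Diag (diagram_of N (order_match S U))" for S U
  have e_car: "e S U \<in> carrier ?T" if "S \<in> I" "U \<in> I" for S U
  proof -
    have SU: "S \<subseteq> {1..N}" "U \<subseteq> {1..N}" "card S = card U" "card S = k"
      using that by (simp_all add: I_def)
    have "num_strands (diagram_of N (order_match S U)) = k"
      using card_order_match[OF SU(1-3)] SU(4) by (simp add: num_strands_def strands_diagram_of)
    moreover have "diagram_of N (order_match S U) \<in> carrier M"
      unfolding C by (rule diagram_of_planar_rook[OF order_match_order_rel[OF SU(1-3)]])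
    ultimately show ?thesis unfolding e_def T(1) using k by blast
  qed
  have e_comp: "\<rho> (e S V) = \<rho> (e S U) * \<rho> (e U V)" if "S \<in> I" "U \<in> I" "V \<in> I" for S U V
  proof -
    have "trunc_mult a M (e S U) (e U V) = e S V"
      using that order_match_comp[of S N U V] card_order_match[of S N V] k
      by (auto simp: I_def e_def mult stack_def num_strands_def strands_diagram_of)
    then show ?thesis using rep(3)[OF e_car[OF that(1,2)] e_car[OF that(2,3)]] by simp
  qed
  have o0: "strands D0 \<in> order_rels N" using strands_planar_rook_diagram(1)[OF D0M] .
  define S0 U0 where "S0 = Domain (strands D0)" and "U0 = Range (strands D0)"
  have SU0: "S0 \<in> I" "U0 \<in> I"
    using Domain_order_rel[OF o0] Range_order_rel[OF o0] card_Domain_order_rel[OF o0]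
      card_Range_order_rel[OF o0]
    by (auto simp: I_def S0_def U0_def k_def num_strands_def)
  have e0: "e S0 U0 = Diag D0"
    using order_rel_eq_order_match[OF o0] strands_planar_rook_diagram(2)[OF D0M]
    by (simp add: e_def S0_def U0_def)
  have e_nz: "\<rho> (e S S) \<noteq> 0\<^sub>m d d" if S: "S \<in> I" for S
  proof
    assume 0: "\<rho> (e S S) = 0\<^sub>m d d"
    \<comment> \<open>The chosen diagram factors through each identity diagram of the same rank.\<close>
    have "\<rho> (Diag D0) = \<rho> (e S0 S) * (\<rho> (e S S) * \<rho> (e S U0))"
      using e_comp[OF SU0(1) S SU0(2)] e_comp[OF S S SU0(2)] by (simp add: e0)
    also have "\<dots> = 0\<^sub>m d d"
      using 0 rep(1)[OF e_car[OF S SU0(2)]] rep(1)[OF e_car[OF SU0(1) S]] by simp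
    finally show False using D0(2) by simp
  qed
  have e_orth: "\<rho> (e S S) * \<rho> (e U U) = 0\<^sub>m d d" if S: "S \<in> I" and U: "U \<in> I" and "S \<noteq> U" for S U
  proof -
    let ?R = "order_match S S O order_match U U"
    have lt: "card ?R < k"
      using card_order_match_comp_less[of S N S U U k] that by (auto simp: I_def)
    have "?R \<in> order_rels N"
      using S U by (intro order_rels_comp order_match_order_rel) (auto simp: I_def)
    then have "Diag (diagram_of N ?R) \<in> carrier ?T" if "a \<le> real (card ?R)"
      using that lt k T(1) C diagram_of_planar_rook
      by (auto simp: num_strands_def strands_diagram_of)
    moreover have "trunc_mult a M (e S S) (e U U)
        = (if real (card ?R) < a then Zero else Diag (diagram_of N ?R))"
      by (simp add: e_def mult stack_def num_strands_def strands_diagram_of)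
    ultimately have "\<rho> (trunc_mult a M (e S S) (e U U)) = 0\<^sub>m d d"
      using P0 lt least[of "diagram_of N ?R"] by (simp add: k_def num_strands_def strands_diagram_of)
    then show ?thesis using rep(3)[OF e_car[OF S S] e_car[OF U U]] by simp
  qed
  have "card I \<le> d"
  proof (rule orthogonal_idempotents_card_le)
    show "finite I" by (simp add: I_def)
    show "\<rho> (e S S) \<in> carrier_mat d d" if "S \<in> I" for S using rep(1) e_car that by blast
    show "\<rho> (e S S) * \<rho> (e S S) = \<rho> (e S S)" if "S \<in> I" for S
      by (rule e_comp[OF that that that, symmetric])
  qed (use e_nz e_orth in blast)+
  moreover have "card I = N choose k" using n_subsets[of "{1..N}" k] by (simp add: I_def)
  ultimately show ?thesis using k by auto
qed

section \<open>Gaps of the truncated monoids\<close>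

lemma pRo_simps:
  "carrier (pRo n) = planar_rook_diagrams (2 * n)" "mult (pRo n) = stack (2 * n)"
  "num_strands \<one>\<^bsub>pRo n\<^esub> = 2 * n"
  by (simp_all add: pRo_def num_strands_def strands_diagram_of Id_on_def UNION_singleton_eq_range
      card_image inj_on_def)

lemma rpRo_simps:
  "carrier (rpRo n) = {D \<in> planar_rook_diagrams (2 * n). \<forall>(i, j) \<in> strands D. letter i = letter j}"
  "mult (rpRo n) = stack (2 * n)" "num_strands \<one>\<^bsub>rpRo n\<^esub> = 2 * n"
  using pRo_simps[of n] by (simp_all add: rpRo_def)

lemma sqrt_double_less: "n > 2 \<Longrightarrow> sqrt (2 * real n) < real n"
  by (rule real_less_lsqrt) (auto simp: power2_eq_square)

lemma pRo_one_out_of_window: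
  assumes "n > 2"
  shows "\<not> (real n - sqrt (2 * real n) \<le> real (num_strands \<one>\<^bsub>pRo n\<^esub>)
    \<and> real (num_strands \<one>\<^bsub>pRo n\<^esub>) \<le> real n + sqrt (2 * real n))"
  using sqrt_double_less[OF assms] by (simp add: pRo_simps)

lemma rpRo_one_out_of_window:
  assumes "n > 2"
  shows "\<not> (real n / 2 - sqrt (2 * real n) \<le> real (num_strands \<one>\<^bsub>rpRo n\<^esub>)
    \<and> real (num_strands \<one>\<^bsub>rpRo n\<^esub>) \<le> real n / 2 + sqrt (2 * real n))"
  using sqrt_double_less[OF assms] by (simp add: rpRo_simps)

text \<open>The minimum defining the gap is attained because the action on the \<open>n\<close>-element subsets is
  an example; without an example the least dimension would have no meaning.\<close>

lemma gap_pRoT_ge: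
  fixes K :: "'k :: field itself"
  assumes n: "n > 2"
  shows "\<exists>k. real n - sqrt (2 * real n) \<le> real k \<and> real k \<le> real n + sqrt (2 * real n)
    \<and> (2 * n choose k) \<le> gap K (pRoT n)"
proof -
  let ?a = "real n - sqrt (2 * real n)" and ?b = "real n + sqrt (2 * real n)"
  note one = pRo_one_out_of_window[OF n]
  have "\<exists>\<rho> :: point set set truncated \<Rightarrow> 'k mat.
    simple_representation (truncation ?a ?b (pRo n)) (card {1..2 * n} choose n) \<rho>
    \<and> \<not> trivial_representation (truncation ?a ?b (pRo n)) (card {1..2 * n} choose n) \<rho>"
  proof (rule subset_rep_simple[OF pRo_simps(2) _ subset_refl])
    show "carrier (pRo n) \<subseteq> planar_rook_diagrams (2 * n)" by (simp add: pRo_simps)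
  next
    fix D i j assume "D \<in> carrier (pRo n)" "(i, j) \<in> strands D"
    then show "j \<in> {1..2 * n}"
      using order_rels_bounded[OF strands_planar_rook_diagram(1)] unfolding pRo_simps by blast
  next
    fix S T :: "nat set" assume "S \<subseteq> {1..2 * n}" "T \<subseteq> {1..2 * n}" "card S = n" "card T = n"
    then show "diagram_of (2 * n) (order_match S T) \<in> carrier (pRo n)"
      unfolding pRo_simps by (intro diagram_of_planar_rook order_match_order_rel) auto
  qed (use n one in auto)
  then have "\<exists>d. \<exists>\<rho> :: point set set truncated \<Rightarrow> 'k mat.
      simple_representation (pRoT n) d \<rho> \<and> \<not> trivial_representation (pRoT n) d \<rho>"
    unfolding pRoT_def by blast
  from LeastI_ex[OF this] obtain \<rho> :: "point set set truncated \<Rightarrow> 'k mat" where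
    "simple_representation (pRoT n) (gap K (pRoT n)) \<rho>"
    "\<not> trivial_representation (pRoT n) (gap K (pRoT n)) \<rho>"
    unfolding gap_def by blast
  then show ?thesis
    using sqrt_double_less[OF n] unfolding pRoT_def
    by (intro nontrivial_simple_dim_ge[OF pRo_simps(2,1) _ one]) (simp_all only: diff_gt_0_iff_gt)
qed

lemma card_odd_positions: "card {i \<in> {1..2 * n}. odd i} = n"
proof -
  have "{i \<in> {1..2 * n}. odd i} = (\<lambda>i. 2 * i + 1) ` {..<n}"
  proof (intro equalityI subsetI)
    fix i assume i: "i \<in> {i \<in> {1..2 * n}. odd i}"
    then have "i \<le> 2 * n" "odd i" by simp_all
    then have "i = 2 * (i div 2) + 1" "i div 2 < n" by presburger+
    then show "i \<in> (\<lambda>i. 2 * i + 1) ` {..<n}" by blast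
  qed auto
  then show ?thesis by (simp add: card_image inj_on_def)
qed

text \<open>Odd positions carry the letter \<open>1\<close>, so rigid strands lead from odd to odd positions, and any two
  sets of odd positions of the same size are joined by a rigid diagram.\<close>

lemma gap_rpRoT_le:
  fixes K :: "'k :: field itself"
  assumes n: "n > 2" and l: "0 < l" "l < n"
    and window: "real n / 2 - sqrt (2 * real n) \<le> real l" "real l \<le> real n / 2 + sqrt (2 * real n)"
  shows "gap K (rpRoT n) \<le> n choose l"
proof -
  let ?a = "real n / 2 - sqrt (2 * real n)" and ?b = "real n / 2 + sqrt (2 * real n)"
  let ?X = "{i \<in> {1..2 * n}. odd i}"
  have "\<exists>\<rho> :: point set set truncated \<Rightarrow> 'k mat.
    simple_representation (truncation ?a ?b (rpRo n)) (card ?X choose l) \<rho>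
    \<and> \<not> trivial_representation (truncation ?a ?b (rpRo n)) (card ?X choose l) \<rho>"
  proof (rule subset_rep_simple[OF rpRo_simps(2)])
    show "carrier (rpRo n) \<subseteq> planar_rook_diagrams (2 * n)" by (auto simp: rpRo_simps)
  next
    fix D i j assume D: "D \<in> carrier (rpRo n)" "(i, j) \<in> strands D" "i \<in> ?X"
    then have D': "D \<in> planar_rook_diagrams (2 * n)" "letter i = letter j"
      unfolding rpRo_simps by blast+
    then have "j \<in> {1..2 * n}"
      using order_rels_bounded[OF strands_planar_rook_diagram(1)] D(2) by blast
    moreover have "odd i" using D(3) by simp
    then have "odd j" using D'(2) unfolding letter_def by presburger
    ultimately show "j \<in> ?X" by simp
  next
    fix S T :: "nat set" assume ST: "S \<subseteq> ?X" "T \<subseteq> ?X" "card S = l" "card T = l"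
    then have sub: "S \<subseteq> {1..2 * n}" "T \<subseteq> {1..2 * n}" "card S = card T" by auto
    have "letter i = letter j" if "(i, j) \<in> order_match S T" for i j
    proof -
      have "i \<in> S" "j \<in> T" using that Domain_order_match[OF sub] Range_order_match[OF sub] by blast+
      then show ?thesis using ST by (auto simp: letter_def)
    qed
    then show "diagram_of (2 * n) (order_match S T) \<in> carrier (rpRo n)"
      using diagram_of_planar_rook[OF order_match_order_rel[OF sub]]
      by (auto simp: rpRo_simps strands_diagram_of)
  next
    show "l < card ?X" unfolding card_odd_positions by (rule l(2))
  qed (use window l(1) rpRo_one_out_of_window[OF n] in blast)+
  then show ?thesis
    unfolding gap_def rpRoT_def card_odd_positions by (rule Least_le)
qed

section \<open>Sizes of the monoids\<close>

lemma finite_planar_rook_diagrams: "finite (planar_rook_diagrams N)"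
proof (rule finite_subset)
  show "planar_rook_diagrams N \<subseteq> diagram_of N ` order_rels N"
    using strands_planar_rook_diagram by (metis image_eqI subsetI)
qed (simp add: finite_order_rels)

lemma card_planar_rook_diagrams:
  "0 < card (planar_rook_diagrams N)" "card (planar_rook_diagrams N) \<le> 4 ^ N"
proof -
  have "{} \<in> order_rels N" by (simp add: order_rels_def)
  then have "planar_rook_diagrams N \<noteq> {}" using diagram_of_planar_rook by blast
  then show "0 < card (planar_rook_diagrams N)"
    using finite_planar_rook_diagrams by (simp add: card_gt_0_iff)
  let ?f = "\<lambda>D. (Domain (strands D), Range (strands D))"
  have "inj_on ?f (planar_rook_diagrams N)"
  proof (rule inj_onI)
    fix D D' assume D: "D \<in> planar_rook_diagrams N" "D' \<in> planar_rook_diagrams N" "?f D = ?f D'"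
    then have "strands D = strands D'"
      using order_rel_eq_order_match[OF strands_planar_rook_diagram(1)] by (metis prod.inject)
    then show "D = D'" using strands_planar_rook_diagram(2) D by metis
  qed
  moreover have "?f ` planar_rook_diagrams N \<subseteq> Pow {1..N} \<times> Pow {1..N}"
  proof
    fix p assume "p \<in> ?f ` planar_rook_diagrams N"
    then obtain D where D: "D \<in> planar_rook_diagrams N" and p: "p = ?f D" by blast
    show "p \<in> Pow {1..N} \<times> Pow {1..N}"
      unfolding p using Domain_order_rel[OF strands_planar_rook_diagram(1)[OF D]]
        Range_order_rel[OF strands_planar_rook_diagram(1)[OF D]] by simp
  qed
  ultimately have "card (planar_rook_diagrams N) \<le> card (Pow {1..N} \<times> Pow {1..N})"
    by (intro card_inj_on_le) auto
  also have "\<dots> = 4 ^ N" by (simp add: card_cartesian_product card_Pow power_mult_distrib[symmetric])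
  finally show "card (planar_rook_diagrams N) \<le> 4 ^ N" .
qed

text \<open>The number of colliding pairs is the sum of the squares of the fibre sizes, to which the
  Cauchy-Schwarz inequality applies.\<close>

lemma card_square_le_collisions:
  assumes A: "finite A" and B: "finite B" and f: "f ` A \<subseteq> B"
  shows "(card A)\<^sup>2 \<le> card B * card {(x, y) \<in> A \<times> A. f x = f y}"
proof -
  define c where "c b = card {x \<in> A. f x = b}" for b
  have "A = (\<Union>b\<in>B. {x \<in> A. f x = b})" using f by blast
  then have "card A = card (\<Union>b\<in>B. {x \<in> A. f x = b})" by simp
  also have "\<dots> = (\<Sum>b\<in>B. c b)"
    unfolding c_def using A B by (intro card_UN_disjoint) auto
  finally have cA: "card A = (\<Sum>b\<in>B. c b)" .
  have "{(x, y) \<in> A \<times> A. f x = f y} = (\<Union>b\<in>B. {x \<in> A. f x = b} \<times> {x \<in> A. f x = b})"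
    using f by (auto simp: image_subset_iff)
  then have "card {(x, y) \<in> A \<times> A. f x = f y} = card (\<Union>b\<in>B. {x \<in> A. f x = b} \<times> {x \<in> A. f x = b})" by simp
  also have "\<dots> = (\<Sum>b\<in>B. card ({x \<in> A. f x = b} \<times> {x \<in> A. f x = b}))"
    using A B by (intro card_UN_disjoint) auto
  also have "\<dots> = (\<Sum>b\<in>B. (c b)\<^sup>2)" by (simp add: c_def card_cartesian_product power2_eq_square)
  finally have cP: "card {(x, y) \<in> A \<times> A. f x = f y} = (\<Sum>b\<in>B. (c b)\<^sup>2)" .
  have "(\<Sum>b\<in>B. real (c b))\<^sup>2 \<le> (\<Sum>b\<in>B. (real (c b))\<^sup>2) * real (card B)"
    using sum_squared_le_sum_of_squares[of "\<lambda>b. real (c b)" B] by simp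
  then have "real ((card A)\<^sup>2) \<le> real (card B * card {(x, y) \<in> A \<times> A. f x = f y})"
    unfolding cA cP by (simp add: mult_ac)
  then show ?thesis by (simp only: of_nat_le_iff)
qed

lemma finite_rpRoT: "n > 2 \<Longrightarrow> finite (carrier (rpRoT n))"
proof -
  assume n: "n > 2"
  have "carrier (rpRoT n) \<subseteq> Diag ` planar_rook_diagrams (2 * n) \<union> {Zero, Unit}"
    unfolding rpRoT_def
    by (auto simp: truncation_simps[OF rpRo_one_out_of_window[OF n]] rpRo_simps)
  then show ?thesis by (rule finite_subset) (simp add: finite_planar_rook_diagrams)
qed

text \<open>Subsets spelling the same word of letters are joined by a rigid diagram, and there are at most
  \<open>2^k\<close> words.\<close>

lemma card_rpRoT_ge:
  assumes n: "n > 2"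
    and k: "real n / 2 - sqrt (2 * real n) \<le> real k" "real k \<le> real n / 2 + sqrt (2 * real n)"
  shows "(2 * n choose k)\<^sup>2 \<le> 2 ^ k * card (carrier (rpRoT n))"
proof -
  define A where "A = {S. S \<subseteq> {1..2 * n} \<and> card S = k}"
  define w where "w S = map letter (sorted_list_of_set S)" for S
  define B :: "nat list set" where "B = {xs. set xs \<subseteq> {1, 2} \<and> length xs = k}"
  let ?P = "{(S, U) \<in> A \<times> A. w S = w U}"
  let ?g = "\<lambda>(S, U). Diag (diagram_of (2 * n) (order_match S U))"
  have A: "finite A" "card A = 2 * n choose k"
    using n_subsets[of "{1..2 * n}" k] by (simp_all add: A_def)
  have B: "finite B" "card B = 2 ^ k"
    using card_lists_length_eq[of "{1, 2 :: nat}" k] finite_lists_length_eq[of "{1, 2 :: nat}" k]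
    by (simp_all add: B_def numeral_2_eq_2)
  have "w ` A \<subseteq> B"
    by (auto simp: w_def A_def B_def letter_def)
  then have "(2 * n choose k)\<^sup>2 \<le> 2 ^ k * card ?P"
    using card_square_le_collisions[of A B w] A B by simp
  also have "card ?P \<le> card (carrier (rpRoT n))"
  proof (rule card_inj_on_le)
    show "inj_on ?g ?P"
    proof (rule inj_onI, clarify)
      fix S U S' U' assume SU: "S \<in> A" "U \<in> A" "S' \<in> A" "U' \<in> A"
        and eq: "diagram_of (2 * n) (order_match S U) = diagram_of (2 * n) (order_match S' U')"
      have "order_match S U = order_match S' U'" using arg_cong[OF eq, of strands] by (simp add: strands_diagram_of)
      moreover have "Domain (order_match X Y) = X \<and> Range (order_match X Y) = Y" if "X \<in> A" "Y \<in> A" for X Y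
      proof -
        have "X \<subseteq> {1..2 * n}" "Y \<subseteq> {1..2 * n}" "card X = card Y" using that by (simp_all add: A_def)
        from Domain_order_match[OF this] Range_order_match[OF this] show ?thesis ..
      qed
      ultimately show "S = S' \<and> U = U'" using SU by metis
    qed
    show "?g ` ?P \<subseteq> carrier (rpRoT n)"
    proof clarify
      fix S U assume SU: "S \<in> A" "U \<in> A" "w S = w U"
      then have sub: "S \<subseteq> {1..2 * n}" "U \<subseteq> {1..2 * n}" "card S = card U" "card S = k"
        by (auto simp: A_def)
      have "letter i = letter j" if ij: "(i, j) \<in> order_match S U" for i j
      proof -
        let ?s = "sorted_list_of_set S" and ?u = "sorted_list_of_set U"
        obtain p where p: "?s ! p = i" "?u ! p = j" "p < length ?s" "p < length ?u"
          using ij unfolding order_match_def in_set_zip fst_conv snd_conv by blast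
        have "w S ! p = w U ! p" using SU(3) by simp
        then show ?thesis using p by (simp add: w_def)
      qed
      then have "diagram_of (2 * n) (order_match S U) \<in> carrier (rpRo n)"
        using diagram_of_planar_rook[OF order_match_order_rel[OF sub(1-3)]]
        by (auto simp: rpRo_simps strands_diagram_of)
      moreover have "num_strands (diagram_of (2 * n) (order_match S U)) = k"
        using card_order_match[OF sub(1-3)] sub(4) by (simp add: num_strands_def strands_diagram_of)
      ultimately show "Diag (diagram_of (2 * n) (order_match S U)) \<in> carrier (rpRoT n)"
        unfolding rpRoT_def truncation_simps(1)[OF rpRo_one_out_of_window[OF n]]
        using k by blast
    qed
  qed (rule finite_rpRoT[OF n])
  finally show ?thesis by simp
qed

section \<open>Estimates for binomial coefficients\<close>

lemma binomial_add_fact: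
  assumes "n = a + b"
  shows "real (n choose a) = fact n / (fact a * fact b)"
  using binomial_fact[of a n, where 'a = real] assms by simp

lemma central_binomial_Suc:
  "real (Suc n) * real (2 * Suc n choose Suc n) = 2 * (2 * real n + 1) * real (2 * n choose n)"
proof -
  have 1: "real (2 * Suc n choose Suc n) = fact (2 * Suc n) / (fact (Suc n) * fact (Suc n))"
    by (rule binomial_add_fact) simp
  have 2: "real (2 * n choose n) = fact (2 * n) / (fact n * fact n)"
    by (rule binomial_add_fact) simp
  have 3: "fact (2 * Suc n) = (2 * real n + 2) * (2 * real n + 1) * fact (2 * n)"
    by (simp add: algebra_simps)
  have nz: "1 + real n \<noteq> 0" by linarith
  show ?thesis unfolding 1 2 3 using nz by (simp add: divide_simps) (simp add: algebra_simps)
qed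

text \<open>Squared, the inequality passes from \<open>n\<close> to \<open>n + 1\<close> because
  \<open>4 n (n + 1) \<le> (2 n + 1)\<^sup>2\<close>.\<close>

lemma central_binomial_ge:
  assumes "n \<ge> 1"
  shows "4 ^ n \<le> 2 * sqrt n * real (2 * n choose n)"
proof -
  have "(4 ^ n)\<^sup>2 \<le> 4 * real n * (real (2 * n choose n))\<^sup>2"
    using assms
  proof (induction n rule: nat_induct_at_least)
    case base
    then show ?case by simp
  next
    case (Suc n)
    let ?c = "real (2 * n choose n)" and ?c' = "real (2 * Suc n choose Suc n)"
    have "(4 ^ Suc n)\<^sup>2 * real (Suc n) = 16 * real (Suc n) * (4 ^ n)\<^sup>2" by (simp add: power_mult_distrib)
    also have "\<dots> \<le> 16 * real (Suc n) * (4 * real n * ?c\<^sup>2)"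
      by (intro mult_left_mono Suc.IH) simp
    also have "\<dots> = (4 * real n * real (Suc n)) * (16 * ?c\<^sup>2)" by simp
    also have "\<dots> \<le> (2 * real n + 1)\<^sup>2 * (16 * ?c\<^sup>2)"
      by (intro mult_right_mono) (auto simp: power2_eq_square algebra_simps)
    also have "\<dots> = 4 * (2 * (2 * real n + 1) * ?c)\<^sup>2"
      by (simp add: power2_eq_square algebra_simps)
    also have "\<dots> = 4 * (real (Suc n) * ?c')\<^sup>2" by (simp only: central_binomial_Suc)
    also have "\<dots> = (4 * real (Suc n) * ?c'\<^sup>2) * real (Suc n)"
      by (simp only: power2_eq_square mult_ac)
    finally show ?case by (rule mult_right_le_imp_le) simp
  qed
  also have "\<dots> = (2 * sqrt n * real (2 * n choose n))\<^sup>2" by (simp add: power_mult_distrib)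
  finally show ?thesis by (rule power2_le_imp_le) simp
qed

text \<open>Moving one step away from the centre, from \<open>n + t\<close> to \<open>n + t + 1\<close>, divides the coefficient by
  \<open>(n + t + 1) / (n - t) = 1 + (2 t + 1) / (n - t)\<close>. By \<open>1 + x \<le> exp x\<close> the exponents
  add up to at most \<open>t\<^sup>2 / (n - s)\<close>, as \<open>t\<^sup>2\<close> is the sum of the first \<open>t\<close> odd numbers.\<close>

lemma central_binomial_decay:
  fixes s :: real
  assumes "real t \<le> s" "s < real n"
  shows "real (2 * n choose n) \<le> real (2 * n choose (n + t)) * exp ((real t)\<^sup>2 / (real n - s))"
  using assms(1)
proof (induction t)
  case (Suc t)
  let ?d = "real n - s"
  have d: "0 < ?d" "?d \<le> real n - real t" using assms(2) Suc.prems by auto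
  have tn: "t < n" using d by linarith
  have "(2 * n - (n + t)) * (2 * n choose (n + t)) = Suc (n + t) * (2 * n choose Suc (n + t))"
    by (metis binomial_absorb_comp binomial_absorption)
  moreover have "2 * n - (n + t) = n - t" by simp
  ultimately have "real (n - t) * real (2 * n choose (n + t)) = real (Suc (n + t)) * real (2 * n choose (n + Suc t))"
    by (metis add_Suc_right of_nat_mult)
  then have "real (2 * n choose (n + t))
      = real (2 * n choose (n + Suc t)) * (1 + (2 * real t + 1) / (real n - real t))"
    using tn by (simp add: field_simps of_nat_diff)
  also have "\<dots> \<le> real (2 * n choose (n + Suc t)) * exp ((2 * real t + 1) / ?d)"
  proof (intro mult_left_mono)
    have "1 + (2 * real t + 1) / (real n - real t) \<le> 1 + (2 * real t + 1) / ?d"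
      using d by (intro add_left_mono divide_left_mono) auto
    also have "\<dots> \<le> exp ((2 * real t + 1) / ?d)" by (rule exp_ge_add_one_self)
    finally show "1 + (2 * real t + 1) / (real n - real t) \<le> exp ((2 * real t + 1) / ?d)" .
  qed simp
  finally have "real (2 * n choose (n + t)) * exp ((real t)\<^sup>2 / ?d)
      \<le> real (2 * n choose (n + Suc t)) * exp ((2 * real t + 1) / ?d) * exp ((real t)\<^sup>2 / ?d)"
    by (rule mult_right_mono) simp
  also have "\<dots> = real (2 * n choose (n + Suc t)) * exp ((real (Suc t))\<^sup>2 / ?d)"
    by (simp add: mult.assoc exp_add[symmetric] add_divide_distrib[symmetric] power2_eq_square algebra_simps)
  finally show ?case using Suc by simp
qed simp

text \<open>By symmetry \<open>2n choose k\<close> only depends on the distance \<open>t \<le> s\<close> of \<open>k\<close> from the centre, and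
  \<open>t\<^sup>2 \<le> 2 n\<close> in the exponent of the decay.\<close>

lemma window_binomial_ge:
  fixes n k :: nat
  defines "s \<equiv> sqrt (2 * real n)"
  assumes n: "n > 2" and k: "real n - s \<le> real k" "real k \<le> real n + s"
  shows "4 ^ n \<le> 2 * sqrt n * exp (2 * real n / (real n - s)) * real (2 * n choose k)"
proof -
  have s: "s\<^sup>2 = 2 * real n" "0 \<le> s" by (simp_all add: s_def)
  have "s\<^sup>2 < (real n)\<^sup>2" unfolding s using n by (simp add: power2_eq_square)
  then have sn: "s < real n" by (rule power2_less_imp_less) simp
  obtain t where t: "real t \<le> s" "(2 * n choose k) = (2 * n choose (n + t))"
  proof (cases "k \<ge> n")
    case True
    then show ?thesis using k(2) by (intro that[of "k - n"]) (auto simp: of_nat_diff)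
  next
    case False
    then have "(2 * n choose k) = (2 * n choose (n + (n - k)))"
      using binomial_symmetric[of k "2 * n"] by (simp add: mult_2)
    then show ?thesis using False k(1) by (intro that[of "n - k"]) (auto simp: of_nat_diff)
  qed
  have "4 ^ n \<le> 2 * sqrt n * real (2 * n choose n)" using n by (intro central_binomial_ge) simp
  also have "\<dots> \<le> 2 * sqrt n * (real (2 * n choose (n + t)) * exp ((real t)\<^sup>2 / (real n - s)))"
    using central_binomial_decay[OF t(1) sn] by (intro mult_left_mono) auto
  also have "\<dots> \<le> 2 * sqrt n * (real (2 * n choose (n + t)) * exp (s\<^sup>2 / (real n - s)))"
    using t(1) sn by (intro mult_left_mono) (auto intro!: divide_right_mono power_mono)
  finally show ?thesis unfolding t(2) s by (simp only: mult_ac)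
qed

text \<open>Averaging over \<open>A\<close>, as all binomial coefficients of \<open>n\<close> add up to \<open>2^n\<close>.\<close>

lemma ex_small_binomial:
  assumes "finite A" "A \<noteq> {}"
  shows "\<exists>k\<in>A. card A * (n choose k) \<le> 2 ^ n"
proof (rule ccontr)
  assume "\<not> ?thesis"
  then have big: "2 ^ n < card A * (n choose k)" if "k \<in> A" for k using that by auto
  have "card A * 2 ^ n = (\<Sum>k\<in>A. 2 ^ n)" by simp
  also have "\<dots> < (\<Sum>k\<in>A. card A * (n choose k))" using assms big by (intro sum_strict_mono) auto
  also have "\<dots> = card A * (\<Sum>k\<in>A. n choose k)" by (simp add: sum_distrib_left)
  also have "(\<Sum>k\<in>A. n choose k) = (\<Sum>k\<in>A \<inter> {..n}. n choose k)"
    by (rule sum.mono_neutral_right) (use assms in auto)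
  also have "\<dots> \<le> (\<Sum>k\<le>n. n choose k)" by (rule sum_mono2) auto
  also have "\<dots> = 2 ^ n" by (rule choose_row_sum)
  finally show False by simp
qed

text \<open>The comparison behind the first inequality: an averaged choice of \<open>l\<close> in the rigid window
  against an arbitrary \<open>k\<close> in the planar window.\<close>

lemma eventually_window_binomials:
  "\<forall>\<^sub>F n in sequentially. \<exists>l. 0 < l \<and> l < n
     \<and> real n / 2 - sqrt (2 * real n) \<le> real l \<and> real l \<le> real n / 2 + sqrt (2 * real n)
     \<and> (\<forall>k. real n - sqrt (2 * real n) \<le> real k \<and> real k \<le> real n + sqrt (2 * real n) \<longrightarrow>
          real (n choose l) \<le> sqrt 2 * exp 2 * 2 powr (- real n) * real (2 * n choose k))"
proof -
  have "2 * sqrt n * exp (2 * real n / (real n - sqrt (2 * real n)))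
      \<le> sqrt 2 * exp 2 * (2 * (sqrt (2 * real n) - 1))"
    if "9 \<le> n" "2 * real n / (real n - sqrt (2 * real n)) \<le> 2 + 1 / 4" for n :: nat
  proof -
    \<comment> \<open>The exponent tends to \<open>2\<close>; allowing \<open>9/4\<close> costs a factor of
      \<open>exp (1/4) \<le> 1 + 1/4 + (1/4)\<^sup>2 = 21/16\<close>, well below the available factor of \<open>2\<close>.\<close>
    have "3 \<le> sqrt n" using that(1) by (intro real_le_rsqrt) simp
    moreover have "sqrt 2 \<le> 3 / 2" by (intro real_le_lsqrt) (simp_all add: power2_eq_square)
    ultimately have "2 * sqrt n * (21 / 16) \<le> sqrt 2 * (2 * (sqrt (2 * real n) - 1))"
      by (simp add: real_sqrt_mult algebra_simps)
    moreover have "exp (2 * real n / (real n - sqrt (2 * real n))) \<le> exp 2 * (21 / 16)"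
    proof -
      have "exp (2 * real n / (real n - sqrt (2 * real n))) \<le> exp (2 + 1 / 4)"
        using that(2) by simp
      also have "\<dots> = exp 2 * exp (1 / 4)" by (rule exp_add)
      also have "\<dots> \<le> exp 2 * (21 / 16)"
        using exp_bound[of "1 / 4"] by (intro mult_left_mono) (simp_all add: power2_eq_square)
      finally show ?thesis .
    qed
    ultimately show ?thesis
      using mult_left_mono[of _ _ "2 * sqrt n"] mult_left_mono[of _ _ "exp 2 :: real"]
      by (smt (verit) exp_ge_zero mult.assoc mult.left_commute of_nat_0_le_iff real_sqrt_ge_zero)
  qed
  moreover have "\<forall>\<^sub>F n :: nat in sequentially. 9 \<le> n \<and> 2 * real n / (real n - sqrt (2 * real n)) \<le> 2 + 1 / 4"
  proof (rule eventually_conj)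
    show "\<forall>\<^sub>F n :: nat in sequentially. 2 * real n / (real n - sqrt (2 * real n)) \<le> 2 + 1 / 4"
      by real_asymp
  qed (rule eventually_ge_at_top)
  ultimately have "\<forall>\<^sub>F n :: nat in sequentially. 2 * sqrt n * exp (2 * real n / (real n - sqrt (2 * real n)))
      \<le> sqrt 2 * exp 2 * (2 * (sqrt (2 * real n) - 1))"
    by (auto elim: eventually_mono)
  moreover have "\<forall>\<^sub>F n :: nat in sequentially. sqrt (2 * real n) + 2 < real n / 2" by real_asymp
  moreover have "\<forall>\<^sub>F n :: nat in sequentially. n > 2" by real_asymp
  ultimately show ?thesis
  proof eventually_elim
    case (elim n)
    let ?s = "sqrt (2 * real n)"
    \<comment> \<open>The interval \<open>{h - r + 1..h + r}\<close> of \<open>2 r\<close> integers lies in the window for both parities of \<open>n\<close>.\<close>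
    define h r where "h = n div 2" and "r = nat \<lfloor>?s\<rfloor>"
    have r: "real r \<le> ?s" "?s < real r + 1" by (simp_all add: r_def)
    have s1: "1 < ?s" using elim(3) by (intro real_less_rsqrt) auto
    have h: "real n / 2 - 1 / 2 \<le> real h" "real h \<le> real n / 2"
      unfolding h_def by linarith+
    have rh: "r < h" "h + r < n" "0 < r" using r h elim(2) s1 by linarith+
    obtain l where l: "l \<in> {h - r + 1..h + r}" "card {h - r + 1..h + r} * (n choose l) \<le> 2 ^ n"
    proof -
      have "{h - r + 1..h + r} \<noteq> {}" using rh by simp
      then show ?thesis using ex_small_binomial[of "{h - r + 1..h + r}" n] that by blast
    qed
    have l_window: "real n / 2 - ?s \<le> real l" "real l \<le> real n / 2 + ?s" "0 < l" "l < n"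
      using l(1) rh r h by auto
    have "card {h - r + 1..h + r} = 2 * r" using rh by simp
    then have "2 * r * (n choose l) \<le> 2 ^ n" using l(2) by simp
    then have "real (2 * r * (n choose l)) \<le> real (2 ^ n)" by (simp only: of_nat_le_iff)
    then have small: "2 * real r * real (n choose l) \<le> 2 ^ n" by simp
    have "real (n choose l) \<le> sqrt 2 * exp 2 * 2 powr (- real n) * real (2 * n choose k)"
      if k: "real n - ?s \<le> real k" "real k \<le> real n + ?s" for k
    proof -
      let ?L = "real (n choose l)" and ?C = "real (2 * n choose k)"
      have pos: "0 < 2 * (?s - 1)" using s1 by simp
      have "(2 * (?s - 1)) * (2 ^ n * ?L) \<le> 2 ^ n * (2 * real r * ?L)"
      proof -
        have "(2 * (?s - 1)) * (2 ^ n * ?L) \<le> (2 * real r) * (2 ^ n * ?L)"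
          using r(2) by (intro mult_right_mono) auto
        then show ?thesis by (simp only: mult_ac)
      qed
      also have "\<dots> \<le> 2 ^ n * 2 ^ n" by (intro mult_left_mono small) simp
      also have "\<dots> = (4 :: real) ^ n" by (simp add: power_mult_distrib[symmetric])
      also have "\<dots> \<le> 2 * sqrt n * exp (2 * real n / (real n - ?s)) * ?C"
        using elim(3) k by (intro window_binomial_ge) auto
      also have "\<dots> \<le> sqrt 2 * exp 2 * (2 * (?s - 1)) * ?C"
        by (intro mult_right_mono elim(1)) simp
      also have "\<dots> = (2 * (?s - 1)) * (sqrt 2 * exp 2 * ?C)" by simp
      finally have "2 ^ n * ?L \<le> sqrt 2 * exp 2 * ?C" using pos by (rule mult_left_le_imp_le)
      then show ?thesis by (simp add: powr_minus powr_realpow field_simps)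
    qed
    then show ?case using l_window by blast
  qed
qed

lemma quarter_binomial_Suc:
  "(3 * real m + 1) * (3 * real m + 2) * (3 * real m + 3) * real (4 * Suc m choose Suc m)
    = 4 * (4 * real m + 1) * (4 * real m + 2) * (4 * real m + 3) * real (4 * m choose m)"
proof -
  have 1: "real (4 * Suc m choose Suc m) = fact (4 * Suc m) / (fact (Suc m) * fact (3 * Suc m))"
    by (rule binomial_add_fact) simp
  have 2: "real (4 * m choose m) = fact (4 * m) / (fact m * fact (3 * m))"
    by (rule binomial_add_fact) simp
  have 3: "fact (4 * Suc m) = (4 * real m + 4) * (4 * real m + 3) * (4 * real m + 2) * (4 * real m + 1) * fact (4 * m)"
    by (simp add: algebra_simps eval_nat_numeral)
  have 4: "fact (3 * Suc m) = (3 * real m + 3) * (3 * real m + 2) * (3 * real m + 1) * fact (3 * m)"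
    by (simp add: algebra_simps eval_nat_numeral)
  have 5: "fact (Suc m) = (real m + 1) * fact m" by simp
  have nz: "3 * real m + 1 \<noteq> 0" "3 * real m + 2 \<noteq> 0" "3 * real m + 3 \<noteq> 0" "real m + 1 \<noteq> 0"
    by linarith+
  show ?thesis unfolding 1 2 3 4 5 using nz by (simp add: divide_simps) (simp add: algebra_simps)
qed

text \<open>The coefficients grow by a factor tending to \<open>256/27\<close>; the factor exceeds \<open>8\<close>
  from \<open>m = 3\<close> on.\<close>

lemma quarter_binomial_ge:
  assumes "m \<ge> 3"
  shows "8 ^ m \<le> 8 ^ 3 * real (4 * m choose m)"
  using assms
proof (induction m rule: nat_induct_at_least)
  case base
  then show ?case by (simp add: binomial_fact' fact_numeral)
next
  case (Suc m)
  let ?c = "real (4 * m choose m)" and ?c' = "real (4 * Suc m choose Suc m)"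
  let ?p = "(3 * real m + 1) * (3 * real m + 2) * (3 * real m + 3)"
  have p: "0 < ?p" by (intro mult_pos_pos) linarith+
  have m: "3 \<le> real m" using Suc.hyps by simp
  have "?p * 8 ^ Suc m = 8 * ?p * 8 ^ m" by simp
  also have "\<dots> \<le> 8 * ?p * (8 ^ 3 * ?c)" using p by (intro mult_left_mono Suc.IH) simp
  also have "\<dots> \<le> (4 * (4 * real m + 1) * (4 * real m + 2) * (4 * real m + 3)) * (8 ^ 3 * ?c)"
  proof (intro mult_right_mono)
    obtain x where x: "real m = 3 + x" "0 \<le> x" using m by (metis add.commute diff_add_cancel diff_ge_0_iff_ge)
    show "8 * ?p \<le> 4 * (4 * real m + 1) * (4 * real m + 2) * (4 * real m + 3)"
      unfolding x(1) using x(2) by (simp add: algebra_simps) 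
  qed simp
  also have "\<dots> = 8 ^ 3 * (4 * (4 * real m + 1) * (4 * real m + 2) * (4 * real m + 3) * ?c)" by simp
  also have "\<dots> = ?p * (8 ^ 3 * ?c')" unfolding quarter_binomial_Suc[symmetric] by (simp only: mult_ac)
  finally show ?case using p by (rule mult_left_le_imp_le)
qed

text \<open>The comparison behind the second inequality, for the sizes \<open>P\<close> and \<open>R\<close> of the planar and of the
  rigid monoid. With \<open>m = n div 2\<close>, squaring reduces it to a bound of \<open>2 * 4^n\<close>, hence of a multiple of
  \<open>16^m\<close>, by a multiple of \<open>(0.87^4 * 32)^m\<close>, and \<open>0.87^4 * 32 > 1.1 * 16\<close>.\<close>

lemma eventually_size_bound:
  "\<forall>\<^sub>F n in sequentially. \<forall>P R :: real. 0 \<le> P \<longrightarrow> P \<le> 16 ^ n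
     \<longrightarrow> (real (2 * n choose (n div 2)))\<^sup>2 \<le> 2 ^ (n div 2) * R
     \<longrightarrow> sqrt 2 * 2 powr (- real n) * sqrt P \<le> (87 / 100) ^ n * sqrt R"
proof -
  obtain m0 where m0: "8 * (8 ^ 3)\<^sup>2 / (87 / 100)\<^sup>2 < ((11 / 10) :: real) ^ m0"
    using real_arch_pow[of "11 / 10"] by auto
  have beats: "8 * (8 ^ 3)\<^sup>2 * 16 ^ m \<le> (87 / 100)\<^sup>2 * ((87 / 100) ^ 4 * 32 :: real) ^ m" if "m \<ge> m0" for m
  proof -
    have "8 * (8 ^ 3)\<^sup>2 \<le> (87 / 100)\<^sup>2 * ((11 / 10) :: real) ^ m0" using m0 by (simp add: field_simps)
    also have "\<dots> \<le> (87 / 100)\<^sup>2 * (11 / 10) ^ m"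
      using that by (intro mult_left_mono power_increasing) auto
    finally have "8 * (8 ^ 3)\<^sup>2 * 16 ^ m \<le> (87 / 100)\<^sup>2 * ((11 / 10) :: real) ^ m * 16 ^ m"
      by (rule mult_right_mono) simp
    also have "\<dots> = (87 / 100)\<^sup>2 * (11 / 10 * 16) ^ m" by (simp only: power_mult_distrib mult.assoc)
    also have "\<dots> \<le> (87 / 100)\<^sup>2 * ((87 / 100) ^ 4 * 32) ^ m"
      by (intro mult_left_mono power_mono) (simp_all add: eval_nat_numeral)
    finally show ?thesis .
  qed
  show ?thesis
    unfolding eventually_sequentially
  proof (intro exI allI impI)
    fix n :: nat and P R :: real
    assume n: "2 * max m0 3 \<le> n" and P: "0 \<le> P" "P \<le> 16 ^ n"
      and R: "(real (2 * n choose (n div 2)))\<^sup>2 \<le> 2 ^ (n div 2) * R"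
    define m where "m = n div 2"
    have m: "m \<ge> m0" "m \<ge> 3" using n by (auto simp: m_def)
    have nm: "2 * m \<le> n" "n \<le> 2 * m + 1" by (auto simp: m_def)
    have "(8 ^ m)\<^sup>2 \<le> (8 ^ 3 * real (4 * m choose m))\<^sup>2"
      using quarter_binomial_ge[OF m(2)] by (intro power_mono) auto
    also have "\<dots> \<le> (8 ^ 3 * real (2 * n choose m))\<^sup>2"
      using nm by (intro power_mono mult_left_mono of_nat_mono binomial_right_mono) auto
    also have "\<dots> \<le> (8 ^ 3)\<^sup>2 * (2 ^ m * R)"
      using R unfolding power_mult_distrib m_def by (intro mult_left_mono) auto
    finally have "32 ^ m * 2 ^ m \<le> ((8 ^ 3)\<^sup>2 * R) * 2 ^ m"
      by (simp add: power_mult_distrib[symmetric] power2_eq_square mult_ac)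
    then have R32: "32 ^ m \<le> (8 ^ 3)\<^sup>2 * R" by (rule mult_right_le_imp_le) simp
    have "0 < (8 ^ 3)\<^sup>2 * R" by (rule less_le_trans[OF _ R32]) simp
    then have R0: "0 \<le> R" by (simp add: zero_less_mult_iff)
    have "(8 ^ 3)\<^sup>2 * (2 * 4 ^ n) \<le> (8 ^ 3)\<^sup>2 * (2 * 4 ^ (2 * m + 1) :: real)"
      using nm by (intro mult_left_mono power_increasing) auto
    also have "\<dots> = 8 * (8 ^ 3)\<^sup>2 * 16 ^ m" by (simp add: power_mult)
    also have "\<dots> \<le> (87 / 100)\<^sup>2 * ((87 / 100) ^ 4 * 32) ^ m" by (rule beats[OF m(1)])
    also have "\<dots> = ((87 / 100) ^ (2 * m + 1))\<^sup>2 * 32 ^ m"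
    proof -
      have "(q ^ (2 * m + 1))\<^sup>2 = q\<^sup>2 * (q ^ 4) ^ m" for q :: real
        unfolding power_mult[symmetric] power_add[symmetric]
        by (rule arg_cong[of _ _ "power q"]) simp
      then show ?thesis by (simp only: power_mult_distrib mult.assoc)
    qed
    also have "\<dots> \<le> ((87 / 100) ^ n)\<^sup>2 * ((8 ^ 3)\<^sup>2 * R)"
      using nm by (intro mult_mono power_mono power_decreasing R32) auto
    finally have "(8 ^ 3)\<^sup>2 * (2 * 4 ^ n) \<le> (8 ^ 3)\<^sup>2 * (((87 / 100) ^ n)\<^sup>2 * R)" by (simp only: mult_ac)
    then have key: "2 * 4 ^ n \<le> ((87 / 100) ^ n)\<^sup>2 * R" by (rule mult_left_le_imp_le) simp
    have "(sqrt 2 * 2 powr (- real n) * sqrt P)\<^sup>2 = 2 * P / 4 ^ n"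
      using P(1) by (simp add: power_mult_distrib powr_minus powr_realpow power2_eq_square
          power_mult_distrib[symmetric] field_simps)
    also have "\<dots> \<le> 2 * 16 ^ n / 4 ^ n" using P(2) by (intro divide_right_mono mult_left_mono) auto
    also have "\<dots> = 2 * 4 ^ n" by (simp add: field_simps power_mult_distrib[symmetric])
    also note key
    also have "((87 / 100) ^ n)\<^sup>2 * R = ((87 / 100) ^ n * sqrt R)\<^sup>2" using R0 by (simp add: power_mult_distrib)
    finally show "sqrt 2 * 2 powr (- real n) * sqrt P \<le> (87 / 100) ^ n * sqrt R"
      by (rule power2_le_imp_le) (use R0 in simp)
  qed
qed

section \<open>Comparison of gaps and ratios\<close>

theorem corollary6p3p7:
  fixes K :: "'k :: field itself"
  shows "\<forall>\<^sub>F n in sequentially.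
    real (gap K (rpRoT n))
      \<le> sqrt 2 * exp (2 + 1 / (3 * real n)) * 2 powr (- real n) * real (gap K (pRoT n))
    \<and> ratio_rpRoT K n
      \<le> pi powr (1 / 4) * exp (2 + 1 / (3 * real n)) * real n powr (1 / 4) * (87 / 100) ^ n
        * ratio_pRoT K n"
  using eventually_window_binomials eventually_size_bound eventually_gt_at_top[of 2]
proof eventually_elim
  case (elim n)
  let ?s = "sqrt (2 * real n)" and ?E = "exp (2 + 1 / (3 * real n))"
  let ?G = "real (gap K (pRoT n))" and ?g = "real (gap K (rpRoT n))"
  let ?P = "real (card (carrier (pRo n)))" and ?R = "real (card (carrier (rpRoT n)))"
  obtain l where l: "0 < l" "l < n" "real n / 2 - ?s \<le> real l" "real l \<le> real n / 2 + ?s"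
    and small: "\<And>k. real n - ?s \<le> real k \<Longrightarrow> real k \<le> real n + ?s \<Longrightarrow>
      real (n choose l) \<le> sqrt 2 * exp 2 * 2 powr (- real n) * real (2 * n choose k)"
    using elim(1) by blast
  obtain k where k: "real n - ?s \<le> real k" "real k \<le> real n + ?s" "(2 * n choose k) \<le> gap K (pRoT n)"
    using gap_pRoT_ge[OF elim(3), of K] by blast
  have "?g \<le> real (n choose l)"
    using gap_rpRoT_le[OF elim(3) l, of K] by simp
  also have "\<dots> \<le> sqrt 2 * exp 2 * 2 powr (- real n) * real (2 * n choose k)"
    by (rule small[OF k(1,2)])
  also have "\<dots> \<le> sqrt 2 * ?E * 2 powr (- real n) * ?G"
    using k(3) by (intro mult_mono) auto
  finally have gap: "?g \<le> sqrt 2 * ?E * 2 powr (- real n) * ?G" .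
  have P: "0 < ?P" "?P \<le> 16 ^ n"
    using card_planar_rook_diagrams[of "2 * n"] of_nat_mono[OF card_planar_rook_diagrams(2)[of "2 * n"], where 'a = real]
    by (simp_all add: pRo_simps power_mult)
  have s1: "1 \<le> ?s" using elim(3) by (intro real_le_rsqrt) auto
  have "real n / 2 - ?s \<le> real (n div 2)" "real (n div 2) \<le> real n / 2 + ?s"
    using s1 by linarith+
  from card_rpRoT_ge[OF elim(3) this]
  have "real ((2 * n choose (n div 2))\<^sup>2) \<le> real (2 ^ (n div 2) * card (carrier (rpRoT n)))"
    by (simp only: of_nat_le_iff)
  then have size: "(real (2 * n choose (n div 2)))\<^sup>2 \<le> 2 ^ (n div 2) * ?R" by simp
  have "0 < real (2 * n choose (n div 2))" by (simp add: zero_less_binomial)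
  then have "0 < 2 ^ (n div 2) * ?R" using size by (meson less_le_trans zero_less_power)
  then have R: "0 < ?R" by (simp add: zero_less_mult_iff)
  have sizes: "sqrt 2 * 2 powr (- real n) * sqrt ?P \<le> (87 / 100) ^ n * sqrt ?R"
    using elim(2) P size by simp
  have one: "1 \<le> pi powr (1 / 4) * real n powr (1 / 4)"
  proof -
    have "1 \<le> pi powr (1 / 4)" "1 \<le> real n powr (1 / 4)"
      using pi_ge_two elim(3) by (auto intro!: ge_one_powr_ge_zero)
    from mult_mono[OF this] show ?thesis by simp
  qed
  have "?g * sqrt ?P \<le> sqrt 2 * ?E * 2 powr (- real n) * ?G * sqrt ?P"
    using gap by (intro mult_right_mono) auto
  also have "\<dots> = (?E * ?G) * (sqrt 2 * 2 powr (- real n) * sqrt ?P)" by simp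
  also have "\<dots> \<le> (?E * ?G) * ((87 / 100) ^ n * sqrt ?R)" by (intro mult_left_mono sizes) simp
  also have "\<dots> \<le> (pi powr (1 / 4) * real n powr (1 / 4)) * ((?E * ?G) * ((87 / 100) ^ n * sqrt ?R))"
    using mult_right_mono[OF one, of "(?E * ?G) * ((87 / 100) ^ n * sqrt ?R)"] by simp
  finally have "?g / sqrt ?R \<le> pi powr (1 / 4) * ?E * real n powr (1 / 4) * (87 / 100) ^ n * (?G / sqrt ?P)"
    using P R by (simp add: divide_simps mult_ac)
  then show ?case using gap by (simp add: ratio_rpRoT_def ratio_pRoT_def)
qed

end
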